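(* Let $n\ge 2$, $\mathfrak g=\mathfrak{sl}_n(\mathbb C)$ with a fixed Borel subalgebra $\mathfrak b$, and let $\widehat W$ be the affine Weyl group of type $\tilde A_{n-1}$. Suppose that $w_1\in\widehat W$ is dominant, that $w_2\in\widehat W$, and that $w_1\sim_{P_L}w_2$. Then $w_2$ is also dominant, and the ad-nilpotent ideals corresponding to $w_1$ and $w_2$ are left equivalent: $I_{w_1}\sim_L I_{w_2}$.
   Context: Setting. $\mathfrak g=\mathfrak{sl}_n(\mathbb C)$, $\mathfrak b$ a Borel subalgebra with nilradical $\mathfrak n$, $\mathfrak h\subset\mathfrak b$ a Cartan subalgebra, $\Delta$ the root system, $\Delta^+$ the positive roots (those of $\mathfrak b$), $\Delta^-=-\Delta^+$, $\Pi$ the simple roots, $\alpha_0$ the highest root, $\mathfrak g_\alpha$ the root spaces, $V=\mathfrak h_{\mathbb R}^*$ with the invariant inner product $(\ ,\ )$. Affine Weyl group. Let $\widehat V=V\oplus\mathbb R\delta\oplus\mathbb R\lambda$, with $(\ ,\ )$ extended by $(\delta,\delta)=(\delta,v)=(\lambda,v)=(\lambda,\lambda)=0$ for $v\in V$ and $(\delta,\lambda)=1$. The affine real roots are $\widehat\Delta=\{\alpha+k\delta:\alpha\in\Delta,k\in\mathbb Z\}$; the positive ones are $\widehat\Delta^+=(\Delta^++\mathbb N\delta)\cup(\Delta^-+\mathbb N^+\delta)$, with $\mathbb N=\{0,1,\dots\}$, $\mathbb N^+=\{1,2,\dots\}$. Write $\alpha>0$ if $\alpha\in\widehat\Delta^+$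 and $\alpha<0$ if $-\alpha\in\widehat\Delta^+$. The affine simple roots are $\widehat\Pi=\Pi\cup\{-\alpha_0+\delta\}$. $\widehat W$ is the group generated by the reflections $s_\alpha(x)=x-\frac{2(\alpha,x)}{(\alpha,\alpha)}\alpha$ of $\widehat V$, $\alpha\in\widehat\Delta$; it is a Coxeter group with simple reflections $S=\{s_\alpha:\alpha\in\widehat\Pi\}$, length function $l$ and Bruhat order $<$. Ideals. An ad-nilpotent ideal is a subspace $I\subset\mathfrak n$ stable under the adjoint action of the Borel subgroup; these are exactly the subspaces $I=\bigoplus_{\alpha\in\mathcal I}\mathfrak g_\alpha$ with $\mathcal I\subset\Delta^+$ a combinatorial ideal: $\alpha\in\mathcal I$, $\beta\in\Delta^+$, $\alpha+\beta\in\Delta$ imply $\alpha+\beta\in\mathcal I$. A root $\alpha$ is a generator of $I$ (or $\mathcal I$) if $\alpha\in\mathcal I$ and $\alpha-\beta\notin\mathcal I$ for every $\beta\in\Delta^+$. Left equivalence of ideals. For $\alpha\in\Pi$ put $\mathfrak l(\alpha)=\mathfrak h\oplus\mathfrak g_\alpha\oplus\mathfrak g_{-\alpha}$. Call $I,J$ elementarily related if, for one ordering of the pair (say $I,J$), $I$ is stable under the adjoint action of $\mathfrak l(\alpha)$ for some $\alpha\in\Pi$, and there is a generator $\beta$ of $I$ with $s_\alpha(\beta)>\beta$ (equivalently $(\alpha,\beta)<0$) such that $I=J\oplus\mathfrak g_\beta$. Two ad-nilpotent ideals $I,J$ are left equivalent, written $I\sim_L J$, if $I=J$ or there is a sequence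 of ad-nilpotent ideals $I=I_1,I_2,\dots,I_k=J$ with each consecutive pair elementarily related. Dominant elements and their ideals. $w\in\widehat W$ is dominant if $w(\alpha)>0$ for all $\alpha\in\Pi$. For dominant $w$, the set $\mathcal I_w=\{\mu\in\Delta^+: w(\delta-\mu)<0\}$ is a combinatorial ideal of $\Delta^+$, and $I_w=\bigoplus_{\mu\in\mathcal I_w}\mathfrak g_\mu$. Left star operation and $P_L$-equivalence. Let $L(w)=\{s\in S: sw<w\}$ (equivalently, $s_\alpha\in L(w)$ for $\alpha\in\widehat\Pi$ iff $w^{-1}(\alpha)<0$). For simple reflections $s,t\in S$ with $st$ of order $3$, let $D_L(s,t)=\{w\in\widehat W: L(w)\cap\{s,t\}\text{ has exactly one element}\}$. If $w\in D_L(s,t)$, then $\{sw,tw\}\cap D_L(s,t)$ has exactly one element, denoted ${}^*w$ (it depends on the pair $s,t$). Write $w\sim_{P_L}w'$ if there is a sequence $w=x_1,x_2,\dots,x_m=w'$ in $\widehat W$ such that for each $i<m$ there are simple reflections $s,t$ (depending on $i$) with $st$ of order $3$, $x_i\in D_L(s,t)$, and $x_{i+1}={}^*x_i$ with respect to $D_L(s,t)$. *)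

theory Defs
  imports "HOL-Analysis.Analysis"
begin

(* The index type 'n is an arbitrary finite linear order, so it is order-isomorphic to
   {1, ..., n} with n = CARD('n).

   For sl_n, a Borel subalgebra is the stabilizer of a complete flag of C^n, and a Cartan
   subalgebra contained in it consists of the traceless matrices that are diagonal in some basis
   adapted to the flag.  A pair (b, h) with h contained in b is therefore given by an invertible
   matrix P, whose columns form such a basis: b and h are the conjugates by P of the upper
   triangular and of the diagonal traceless matrices.  P = mat 1 is the standard choice. *)

type_synonym 'n rvec = "(real, 'n) vec"
type_synonym 'n cmat = "((complex, 'n) vec, 'n) vec"

section \<open>The finite root system\<close>

text \<open>The space V is the space of vectors of coordinate sum 0 in R^n, with the standard inner product;
  the functional with coordinates v takes diag(d) to the sum of the \<open>v $ i * d $ i\<close>.\<close>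

definition root_vec :: "'n \<Rightarrow> 'n \<Rightarrow> 'n::{finite,linorder} rvec" where
  "root_vec i j = axis i 1 - axis j 1"

definition roots :: "'n::{finite,linorder} rvec set" where
  "roots = {root_vec i j | i j. i \<noteq> j}"

definition pos_roots :: "'n::{finite,linorder} rvec set" where
  "pos_roots = {root_vec i j | i j. i < j}"

definition simple_roots :: "'n::{finite,linorder} rvec set" where
  "simple_roots = {\<alpha> \<in> pos_roots. \<not> (\<exists>\<beta>\<in>pos_roots. \<exists>\<gamma>\<in>pos_roots. \<alpha> = \<beta> + \<gamma>)}"

definition highest_root :: "'n::{finite,linorder} rvec" where
  "highest_root = root_vec (Min UNIV) (Max UNIV)"

definition fin_refl :: "'n rvec \<Rightarrow> 'n rvec \<Rightarrow> 'n::{finite,linorder} rvec" where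
  "fin_refl \<alpha> x = x - (2 * (\<alpha> \<bullet> x) / (\<alpha> \<bullet> \<alpha>)) *\<^sub>R \<alpha>"

definition root_less :: "'n rvec \<Rightarrow> 'n::{finite,linorder} rvec \<Rightarrow> bool" where
  "root_less \<mu> \<nu> \<longleftrightarrow> \<mu> \<noteq> \<nu> \<and>
     (\<exists>c :: 'n rvec \<Rightarrow> nat. \<nu> - \<mu> = (\<Sum>\<alpha>\<in>simple_roots. real (c \<alpha>) *\<^sub>R \<alpha>))"

section \<open>The Lie algebra\<close>

definition cscale :: "complex \<Rightarrow> 'n cmat \<Rightarrow> 'n::finite cmat" where
  "cscale c X = (\<chi> i j. c * X $ i $ j)"

definition complex_subspace :: "'n::finite cmat set \<Rightarrow> bool" where
  "complex_subspace I \<longleftrightarrow> 0 \<in> I \<and> (\<forall>X\<in>I. \<forall>Y\<in>I. X + Y \<in> I) \<and> (\<forall>c. \<forall>X\<in>I. cscale c X \<in> I)"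

definition bracket :: "'n cmat \<Rightarrow> 'n cmat \<Rightarrow> 'n::finite cmat" where
  "bracket X Y = X ** Y - Y ** X"

definition sl :: "'n::finite cmat set" where
  "sl = {X. trace X = 0}"

definition conj_by :: "'n cmat \<Rightarrow> 'n cmat \<Rightarrow> 'n::finite cmat" where
  "conj_by P X = P ** X ** matrix_inv P"

definition diag :: "complex^'n \<Rightarrow> 'n cmat" where
  "diag d = (\<chi> i j. if i = j then d $ i else 0)"

definition cartan :: "'n cmat \<Rightarrow> 'n::finite cmat set" where
  "cartan P = {conj_by P (diag d) | d. (\<Sum>i\<in>UNIV. d $ i) = 0}"

definition nilradical :: "'n cmat \<Rightarrow> 'n::{finite,linorder} cmat set" where
  "nilradical P = {conj_by P U | U. \<forall>i j. j \<le> i \<longrightarrow> U $ i $ j = 0}"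

definition borel_group :: "'n cmat \<Rightarrow> 'n::{finite,linorder} cmat set" where
  "borel_group P = {conj_by P T | T. det T = 1 \<and> (\<forall>i j. j < i \<longrightarrow> T $ i $ j = 0)}"

definition root_space :: "'n cmat \<Rightarrow> 'n rvec \<Rightarrow> 'n::{finite,linorder} cmat set" where
  "root_space P \<alpha> = {X \<in> sl. \<forall>d. (\<Sum>i\<in>UNIV. d $ i) = 0 \<longrightarrow>
     bracket (conj_by P (diag d)) X = cscale (\<Sum>i\<in>UNIV. complex_of_real (\<alpha> $ i) * d $ i) X}"

definition levi :: "'n cmat \<Rightarrow> 'n rvec \<Rightarrow> 'n::{finite,linorder} cmat set" where
  "levi P \<alpha> = {H + X + Y | H X Y.
     H \<in> cartan P \<and> X \<in> root_space P \<alpha> \<and> Y \<in> root_space P (- \<alpha>)}"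

section \<open>Ad-nilpotent ideals and left equivalence\<close>

definition ad_nilpotent_ideal :: "'n cmat \<Rightarrow> 'n::{finite,linorder} cmat set \<Rightarrow> bool" where
  "ad_nilpotent_ideal P I \<longleftrightarrow> complex_subspace I \<and> I \<subseteq> nilradical P \<and>
     (\<forall>g\<in>borel_group P. \<forall>X\<in>I. conj_by g X \<in> I)"

definition ideal_roots :: "'n cmat \<Rightarrow> 'n cmat set \<Rightarrow> 'n::{finite,linorder} rvec set" where
  "ideal_roots P I = {\<alpha> \<in> pos_roots. root_space P \<alpha> \<subseteq> I}"

definition generator :: "'n cmat \<Rightarrow> 'n cmat set \<Rightarrow> 'n::{finite,linorder} rvec \<Rightarrow> bool" where
  "generator P I \<alpha> \<longleftrightarrow> \<alpha> \<in> ideal_roots P I \<and> (\<forall>\<beta>\<in>pos_roots. \<alpha> - \<beta> \<notin> ideal_roots P I)"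

definition direct_sum_of ::
  "'n cmat set \<Rightarrow> 'n cmat set \<Rightarrow> 'n::finite cmat set \<Rightarrow> bool" where
  "direct_sum_of I J K \<longleftrightarrow> I = {X + Y | X Y. X \<in> J \<and> Y \<in> K} \<and> J \<inter> K = {0}"

definition elementary_step ::
  "'n cmat \<Rightarrow> 'n cmat set \<Rightarrow> 'n::{finite,linorder} cmat set \<Rightarrow> bool" where
  "elementary_step P I J \<longleftrightarrow>
     (\<exists>\<alpha>\<in>simple_roots. (\<forall>X\<in>levi P \<alpha>. \<forall>Y\<in>I. bracket X Y \<in> I) \<and>
       (\<exists>\<beta>. generator P I \<beta> \<and> root_less \<beta> (fin_refl \<alpha> \<beta>) \<and>
            direct_sum_of I J (root_space P \<beta>)))"

definition elementarily_related ::
  "'n cmat \<Rightarrow> 'n cmat set \<Rightarrow> 'n::{finite,linorder} cmat set \<Rightarrow> bool" where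
  "elementarily_related P I J \<longleftrightarrow> ad_nilpotent_ideal P I \<and> ad_nilpotent_ideal P J \<and>
     (elementary_step P I J \<or> elementary_step P J I)"

definition left_equivalent ::
  "'n cmat \<Rightarrow> 'n cmat set \<Rightarrow> 'n::{finite,linorder} cmat set \<Rightarrow> bool" where
  "left_equivalent P I J \<longleftrightarrow> ad_nilpotent_ideal P I \<and> ad_nilpotent_ideal P J \<and>
     (elementarily_related P)\<^sup>*\<^sup>* I J"

section \<open>The affine Weyl group\<close>

text \<open>A triple (v, a, b) with v in V stands for \<open>v + a \<delta> + b \<lambda>\<close>.\<close>

type_synonym 'n affine = "'n rvec \<times> real \<times> real"

definition Vhat :: "'n::{finite,linorder} affine set" where
  "Vhat = {(v, a, b) | v a b. (\<Sum>i\<in>UNIV. v $ i) = 0}"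

fun form :: "'n::{finite,linorder} affine \<Rightarrow> 'n affine \<Rightarrow> real" where
  "form (v, a, b) (v', a', b') = v \<bullet> v' + a * b' + b * a'"

definition aff :: "'n rvec \<Rightarrow> int \<Rightarrow> 'n::{finite,linorder} affine" where
  "aff \<alpha> k = (\<alpha>, real_of_int k, 0)"

definition affine_roots :: "'n::{finite,linorder} affine set" where
  "affine_roots = {aff \<alpha> k | \<alpha> k. \<alpha> \<in> roots}"

definition affine_pos_roots :: "'n::{finite,linorder} affine set" where
  "affine_pos_roots = {aff \<alpha> k | \<alpha> k. \<alpha> \<in> pos_roots \<and> k \<ge> 0}
                    \<union> {aff (- \<alpha>) k | \<alpha> k. \<alpha> \<in> pos_roots \<and> k \<ge> 1}"

definition aff_pos :: "'n::{finite,linorder} affine \<Rightarrow> bool" where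
  "aff_pos x \<longleftrightarrow> x \<in> affine_pos_roots"

definition aff_neg :: "'n::{finite,linorder} affine \<Rightarrow> bool" where
  "aff_neg x \<longleftrightarrow> - x \<in> affine_pos_roots"

definition affine_simple_roots :: "'n::{finite,linorder} affine set" where
  "affine_simple_roots = (\<lambda>\<alpha>. aff \<alpha> 0) ` simple_roots \<union> {aff (- highest_root) 1}"

(* Transformations of Vhat are extended by the identity to the whole type, so that their
   composition and equality are those of functions. *)
definition aff_refl :: "'n affine \<Rightarrow> 'n affine \<Rightarrow> 'n::{finite,linorder} affine" where
  "aff_refl \<alpha> x = (if x \<in> Vhat then x - (2 * form \<alpha> x / form \<alpha> \<alpha>) *\<^sub>R \<alpha> else x)"

(* Reflections are involutions, so closure under products already gives a group. *)
inductive_set What :: "('n affine \<Rightarrow> 'n::{finite,linorder} affine) set" where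
  one: "id \<in> What"
| mult: "\<alpha> \<in> affine_roots \<Longrightarrow> w \<in> What \<Longrightarrow> aff_refl \<alpha> \<circ> w \<in> What"

definition simple_refls :: "('n affine \<Rightarrow> 'n::{finite,linorder} affine) set" where
  "simple_refls = aff_refl ` affine_simple_roots"

definition len :: "('n affine \<Rightarrow> 'n::{finite,linorder} affine) \<Rightarrow> nat" where
  "len w = (LEAST k. \<exists>ss. length ss = k \<and> set ss \<subseteq> simple_refls \<and> w = foldr (\<circ>) ss id)"

(* The aff_refl \<alpha>, for \<alpha> an affine real root, are exactly the conjugates of the simple reflections. *)
definition bruhat_step ::
  "('n affine \<Rightarrow> 'n affine) \<Rightarrow> ('n affine \<Rightarrow> 'n::{finite,linorder} affine) \<Rightarrow> bool" where
  "bruhat_step u w \<longleftrightarrow> u \<in> What \<and> (\<exists>\<alpha>\<in>affine_roots. w = aff_refl \<alpha> \<circ> u) \<and> len u < len w"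

definition bruhat_less ::
  "('n affine \<Rightarrow> 'n affine) \<Rightarrow> ('n affine \<Rightarrow> 'n::{finite,linorder} affine) \<Rightarrow> bool" where
  "bruhat_less = bruhat_step\<^sup>+\<^sup>+"

section \<open>Left star operations\<close>

definition left_descents ::
  "('n affine \<Rightarrow> 'n affine) \<Rightarrow> ('n affine \<Rightarrow> 'n::{finite,linorder} affine) set" where
  "left_descents w = {s \<in> simple_refls. bruhat_less (s \<circ> w) w}"

definition order_three :: "('a \<Rightarrow> 'a) \<Rightarrow> bool" where
  "order_three f \<longleftrightarrow> f ^^ 3 = id \<and> (\<forall>k. 0 < k \<and> k < 3 \<longrightarrow> f ^^ k \<noteq> id)"

definition DL :: "('n affine \<Rightarrow> 'n affine) \<Rightarrow> ('n affine \<Rightarrow> 'n affine)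
    \<Rightarrow> ('n affine \<Rightarrow> 'n::{finite,linorder} affine) set" where
  "DL s t = {w \<in> What. card (left_descents w \<inter> {s, t}) = 1}"

definition star_step ::
  "('n affine \<Rightarrow> 'n affine) \<Rightarrow> ('n affine \<Rightarrow> 'n::{finite,linorder} affine) \<Rightarrow> bool" where
  "star_step w w' \<longleftrightarrow> (\<exists>s\<in>simple_refls. \<exists>t\<in>simple_refls. order_three (s \<circ> t) \<and>
     w \<in> DL s t \<and> {s \<circ> w, t \<circ> w} \<inter> DL s t = {w'})"

definition PL_equivalent ::
  "('n affine \<Rightarrow> 'n affine) \<Rightarrow> ('n affine \<Rightarrow> 'n::{finite,linorder} affine) \<Rightarrow> bool" where
  "PL_equivalent = star_step\<^sup>*\<^sup>*"

section \<open>Dominant elements and their ideals\<close>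

definition dominant :: "('n affine \<Rightarrow> 'n::{finite,linorder} affine) \<Rightarrow> bool" where
  "dominant w \<longleftrightarrow> (\<forall>\<alpha>\<in>simple_roots. aff_pos (w (aff \<alpha> 0)))"

definition comb_ideal :: "('n affine \<Rightarrow> 'n::{finite,linorder} affine) \<Rightarrow> 'n rvec set" where
  "comb_ideal w = {\<mu> \<in> pos_roots. aff_neg (w (aff (- \<mu>) 1))}"

definition ideal_of ::
  "'n cmat \<Rightarrow> ('n affine \<Rightarrow> 'n::{finite,linorder} affine) \<Rightarrow> 'n cmat set" where
  "ideal_of P w = {\<Sum>\<mu>\<in>comb_ideal w. X \<mu> | X. \<forall>\<mu>\<in>comb_ideal w. X \<mu> \<in> root_space P \<mu>}"

end

theory Submission
  imports Defs
begin

text \<open>Heights turn the affine root combinatorics into arithmetic: \<open>ht\<close> is linear, positive exactly on the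
  positive affine roots and equal to 1 on the simple ones. By the exchange argument
  \<open>aff_refl a\<close> is a left descent of \<open>w\<close> iff \<open>x = w\<^sup>-\<^sup>1 a\<close> has negative height. For a star operation with
  respect to the simple roots \<open>a\<close>, \<open>b\<close>, with \<open>c = w\<^sup>-\<^sup>1 b\<close>, one may assume \<open>x < 0 < c\<close> and \<open>x + c < 0\<close>, the new element
  being \<open>aff_refl a \<circ> w\<close>. The two ideals then coincide unless \<open>x = \<mu> - \<delta>\<close> with \<open>\<mu>\<close> positive, and in that
  case dominance forces \<open>c\<close> to be a finite simple root; \<open>\<mu>\<close> is the generator that is removed and the ideal of \<open>w\<close> is
  stable under \<open>levi P c\<close>.\<close>

section \<open>Roots of sl_n as differences of coordinate vectors: inner products and
  reflections\<close>

section \<open>The finite roots\<close>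

text \<open>Heights of affine roots are nonzero integers, and this gap carries the arguments:
  positive roots have height at least 1, while \<open>a\<close> and \<open>b\<close> have height
  exactly 1. A simple reflection \<open>aff_refl a\<close> changes the sign of no root except
  \<open>a\<close> and \<open>- a\<close>. Passing from \<open>w\<close> to
  \<open>aff_refl a \<circ> w\<close> can therefore spoil dominance only if \<open>x\<close> is a
  finite simple root; membership of both elements in \<open>DL\<close> excludes this, since
  \<open>x\<close> is then negative or of height above 1. For the same reason the ideal can change
  only at a \<mu> with \<delta> - \<mu> = - \<open>x\<close>. The condition \<open>x + c\<close> < 0
  is the \<open>DL\<close> condition for the new element, whose preimages of \<open>a\<close> and
  \<open>b\<close> are \<open>- x\<close> and \<open>x + c\<close>. Levi stability comes from
  \<open>w c = b\<close>: subtracting the finite root \<open>c\<close> from a root \<eta> of the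
  ideal raises the height of \<open>w\<close> at \<delta> - \<eta> by just 1, which cannot turn a
  negative height into a positive one. On the Lie algebra side, conjugation by \<open>P\<close> is
  stripped off and a subspace is described by the matrix positions at which entries may be
  nonzero.\<close>

lemma root_vec_nth: "root_vec i j $ k = (if k = i then 1 else 0) - (if k = j then 1 else 0)"
  by (simp add: root_vec_def axis_def)

lemma root_vec_self [simp]: "root_vec i i = 0"
  by (simp add: root_vec_def)

lemma uminus_root_vec: "- root_vec i j = root_vec j i"
  by (simp add: root_vec_def)

lemma root_vec_add: "root_vec i j + root_vec j k = root_vec i k"
  by (simp add: root_vec_def)

lemma root_vec_inject:
  assumes "i \<noteq> j" "root_vec i j = root_vec k l" shows "k = i \<and> l = j"
proof -
  have "root_vec i j $ i = root_vec k l $ i" "root_vec i j $ j = root_vec k l $ j"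
    using assms by auto
  then show ?thesis using assms(1) by (auto simp: root_vec_nth split: if_splits)
qed

lemma root_vec_sum_nth: "(\<Sum>m\<in>UNIV. root_vec i j $ m) = 0"
  by (simp add: root_vec_nth sum_subtractf)

lemma root_vec_inner: "root_vec i j \<bullet> v = v $ i - v $ j"
  by (simp add: root_vec_def inner_diff_left inner_axis')

lemma root_vec_in_pos_roots_iff [simp]: "root_vec i j \<in> pos_roots \<longleftrightarrow> i < j"
  unfolding pos_roots_def using root_vec_inject
  by (smt (verit) less_irrefl mem_Collect_eq)

lemma root_vec_in_roots_iff [simp]: "root_vec i j \<in> roots \<longleftrightarrow> i \<noteq> j"
  unfolding roots_def using root_vec_inject root_vec_self
  by (smt (verit) mem_Collect_eq)

lemma pos_roots_subset_roots: "pos_roots \<subseteq> roots"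
  by (auto simp: pos_roots_def)

lemma simple_roots_subset_pos_roots: "simple_roots \<subseteq> pos_roots"
  by (auto simp: simple_roots_def)

lemma finite_roots: "finite (roots :: 'n::{finite,linorder} rvec set)"
proof -
  have "roots = (\<lambda>(i, j). root_vec i j) ` {(i, j). i \<noteq> (j::'n)}"
    by (auto simp: roots_def)
  then show ?thesis by (metis finite finite_imageI)
qed

lemma uminus_roots: "v \<in> roots \<Longrightarrow> - v \<in> roots"
  by (auto simp: roots_def) (metis uminus_root_vec)

lemma pos_root_cases:
  assumes "v \<in> roots" shows "v \<in> pos_roots \<or> - v \<in> pos_roots"
  using assms by (auto simp: roots_def uminus_root_vec)

lemma root_norm: "v \<in> roots \<Longrightarrow> v \<bullet> v = 2"
  by (auto simp: roots_def root_vec_inner root_vec_nth)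

lemma root_inner_cases:
  assumes "u \<in> roots" "v \<in> roots"
  shows "u \<bullet> v \<in> {-2, -1, 0, 1, 2}"
  using assms by (auto simp: roots_def root_vec_inner root_vec_nth split: if_splits)

lemma root_inner_eq_2:
  assumes "u \<in> roots" "v \<in> roots" "u \<bullet> v = 2" shows "u = v"
proof -
  have "(u - v) \<bullet> (u - v) = 0"
    using assms by (simp add: inner_diff_left inner_diff_right root_norm inner_commute)
  then show ?thesis by simp
qed

text \<open>Reflection in the root with indices i, j swaps the coordinates i and j, so it applies
  this transposition to the indices of the other root.\<close>

lemma roots_reflect:
  assumes "u \<in> roots" "v \<in> roots" shows "v - (u \<bullet> v) *\<^sub>R u \<in> roots"
proof -
  obtain i j where u: "u = root_vec i j" "i \<noteq> j" using assms by (auto simp: roots_def)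
  obtain k l where v: "v = root_vec k l" "k \<noteq> l" using assms by (auto simp: roots_def)
  have "v - (u \<bullet> v) *\<^sub>R u = root_vec (Transposition.transpose i j k) (Transposition.transpose i j l)"
    unfolding u v using u(2) v(2) by (auto simp: vec_eq_iff root_vec_inner root_vec_nth Transposition.transpose_def)
  moreover have "Transposition.transpose i j k \<noteq> Transposition.transpose i j l"
    using v by (auto simp: Transposition.transpose_def)
  ultimately show ?thesis by simp
qed

section \<open>An integral linear functional that detects positive affine roots\<close>

section \<open>Heights\<close>

text \<open>Zero-based position in the linear order: it brings integer arithmetic to the abstract
  index type.\<close>

definition rk :: "'n::{finite,linorder} \<Rightarrow> int" where
  "rk i = int (card {..<i})"

lemma rk_strict_mono: "i < j \<Longrightarrow> rk i < rk j"
  unfolding rk_def of_nat_less_iff by (rule psubset_card_mono) auto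

lemma rk_less_iff [simp]: "rk i < rk j \<longleftrightarrow> i < j"
  using rk_strict_mono[of i j] rk_strict_mono[of j i] by (cases i j rule: linorder_cases) auto

lemma rk_bounds: "0 \<le> rk i" "rk (i :: 'n::{finite,linorder}) < int CARD('n)"
  unfolding rk_def using psubset_card_mono[of UNIV "{..<i}"] by auto

definition ht :: "'n::{finite,linorder} affine \<Rightarrow> real" where
  "ht x = real CARD('n) * fst (snd x) - (\<Sum>i\<in>UNIV. fst x $ i * real_of_int (rk i))"

lemma ht_add: "ht (x + y) = ht x + ht y"
  and ht_minus: "ht (- x) = - ht x"
  and ht_diff: "ht (x - y) = ht x - ht y"
  and ht_scale: "ht (c *\<^sub>R x) = c * ht x"
  by (simp_all add: ht_def algebra_simps sum.distrib sum_subtractf sum_negf sum_distrib_left)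

lemma ht_root_vec:
  "ht (aff (root_vec i j :: 'n::{finite,linorder} rvec) k) = of_int (int CARD('n) * k + rk j - rk i)"
  by (simp add: ht_def aff_def root_vec_nth left_diff_distrib sum_subtractf
        if_distrib[of "\<lambda>x. x * _"] cong: if_cong)

lemma uminus_aff: "- aff v k = aff (- v) (- k)"
  by (simp add: aff_def)

lemma aff_add: "aff u k + aff v l = aff (u + v) (k + l)"
  by (simp add: aff_def)

lemma aff_inject [simp]: "aff u k = aff v l \<longleftrightarrow> u = v \<and> k = l"
  by (simp add: aff_def)

lemma affine_rootsE:
  assumes "x \<in> affine_roots"
  obtains i j k where "i \<noteq> j" "x = aff (root_vec i j) k"
  using assms by (auto simp: affine_roots_def roots_def)

lemma aff_in_affine_roots [simp]: "aff v k \<in> affine_roots \<longleftrightarrow> v \<in> roots"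
  by (auto simp: affine_roots_def)

lemma uminus_affine_roots: "x \<in> affine_roots \<Longrightarrow> - x \<in> affine_roots"
  by (auto simp: affine_roots_def uminus_aff uminus_roots)

text \<open>Positions differ by less than n, so the sign is that of k when k is nonzero and that of
  the difference of positions otherwise.\<close>

lemma affine_rk_sign:
  fixes i j :: "'n::{finite,linorder}"
  assumes "i \<noteq> j"
  shows "int CARD('n) * k + rk j - rk i > 0 \<longleftrightarrow> (i < j \<and> k \<ge> 0) \<or> (j < i \<and> k \<ge> 1)"
    and "int CARD('n) * k + rk j - rk i \<noteq> 0"
proof -
  have b: "0 \<le> rk i" "rk i < int CARD('n)" "0 \<le> rk j" "rk j < int CARD('n)"
    by (simp_all add: rk_bounds)
  have r: "i < j \<longleftrightarrow> rk i < rk j" "j < i \<longleftrightarrow> rk j < rk i" "rk i \<noteq> rk j"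
    using assms rk_less_iff by (metis less_irrefl neqE)+
  consider "k \<ge> 1" | "k = 0" | "k \<le> -1" by linarith
  then have "(int CARD('n) * k + rk j - rk i > 0 \<longleftrightarrow> (i < j \<and> k \<ge> 0) \<or> (j < i \<and> k \<ge> 1))
     \<and> int CARD('n) * k + rk j - rk i \<noteq> 0"
  proof cases
    case 1
    then have "int CARD('n) * k \<ge> int CARD('n)" by (simp add: mult_le_cancel_left1)
    then show ?thesis using b r 1 by linarith
  next
    case 2 then show ?thesis using r by auto
  next
    case 3
    then have "int CARD('n) * k \<le> int CARD('n) * (-1)" by (intro mult_left_mono) auto
    then show ?thesis using b r 3 by linarith
  qed
  then show "int CARD('n) * k + rk j - rk i > 0 \<longleftrightarrow> (i < j \<and> k \<ge> 0) \<or> (j < i \<and> k \<ge> 1)"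
    and "int CARD('n) * k + rk j - rk i \<noteq> 0" by auto
qed

lemma ht_affine_root:
  assumes "x \<in> affine_roots"
  obtains m :: int where "m \<noteq> 0" "ht x = of_int m"
proof -
  obtain i j k where "i \<noteq> j" "x = aff (root_vec i j) k" using assms by (rule affine_rootsE)
  then show ?thesis using that affine_rk_sign(2) ht_root_vec by metis
qed

lemma affine_root_ht_nonzero: "x \<in> affine_roots \<Longrightarrow> ht x \<noteq> 0"
  by (metis ht_affine_root of_int_eq_0_iff)

lemma affine_root_ht_pos: "x \<in> affine_roots \<Longrightarrow> ht x > 0 \<Longrightarrow> ht x \<ge> 1"
  by (metis ht_affine_root of_int_0_less_iff of_int_1_le_iff int_one_le_iff_zero_less)

lemma affine_pos_roots_iff: "x \<in> affine_pos_roots \<longleftrightarrow> x \<in> affine_roots \<and> ht x > 0"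
proof (cases "x \<in> affine_roots")
  case True
  then obtain i j k where x: "i \<noteq> j" "x = aff (root_vec i j) k" by (rule affine_rootsE)
  have "x \<in> affine_pos_roots \<longleftrightarrow> (i < j \<and> k \<ge> 0) \<or> (j < i \<and> k \<ge> 1)"
  proof -
    have 1: "x \<in> {aff \<alpha> k |\<alpha> k. \<alpha> \<in> pos_roots \<and> 0 \<le> k} \<longleftrightarrow> i < j \<and> k \<ge> 0"
      by (auto simp: x)
    have "root_vec i j = - \<alpha> \<longleftrightarrow> \<alpha> = root_vec j i" for \<alpha>
      by (metis uminus_root_vec minus_minus)
    then have 2: "x \<in> {aff (- \<alpha>) k |\<alpha> k. \<alpha> \<in> pos_roots \<and> 1 \<le> k} \<longleftrightarrow> j < i \<and> k \<ge> 1"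
      by (auto simp: x)
    show ?thesis unfolding affine_pos_roots_def using 1 2 by blast
  qed
  also have "\<dots> \<longleftrightarrow> ht x > 0"
    by (simp only: x ht_root_vec of_int_0_less_iff affine_rk_sign(1)[OF x(1)])
  finally show ?thesis using True by simp
next
  case False
  have "affine_pos_roots \<subseteq> affine_roots"
    using pos_roots_subset_roots unfolding affine_pos_roots_def
    by (auto simp del: split_paired_All intro!: uminus_roots iffD2[OF aff_in_affine_roots])
  then show ?thesis using False by auto
qed

lemma aff_pos_iff: "aff_pos x \<longleftrightarrow> x \<in> affine_roots \<and> ht x > 0"
  by (simp add: aff_pos_def affine_pos_roots_iff)

lemma aff_neg_iff: "aff_neg x \<longleftrightarrow> x \<in> affine_roots \<and> ht x < 0"
  unfolding aff_neg_def affine_pos_roots_iff ht_minus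
  using uminus_affine_roots[of x] uminus_affine_roots[of "- x"] by auto

lemma ht_pos_root_iff: "v \<in> roots \<Longrightarrow> ht (aff v 0) > 0 \<longleftrightarrow> v \<in> pos_roots"
  using affine_rk_sign(1)[where k = 0] by (auto simp: roots_def ht_root_vec)

lemma ht_aff_shift: "ht (aff (v :: 'n::{finite,linorder} rvec) k) = real CARD('n) * of_int k + ht (aff v 0)"
  by (simp add: ht_def aff_def)

lemma ht_root_bound:
  "v \<in> roots \<Longrightarrow> \<bar>ht (aff (v :: 'n::{finite,linorder} rvec) 0)\<bar> < real CARD('n)"
proof -
  assume "v \<in> roots"
  then obtain i j where v: "v = root_vec i j" by (auto simp: roots_def)
  have "\<bar>rk j - rk i\<bar> < int CARD('n)"
    using rk_bounds[of i] rk_bounds[of j] by linarith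
  then show ?thesis unfolding v ht_root_vec by simp
qed

text \<open>An index strictly between would split the root into two positive ones. Adjacency of the
  two indices has to be derived because \<open>simple_roots\<close> is defined by
  indecomposability.\<close>

lemma simple_roots_not_between:
  "root_vec i j \<in> simple_roots \<Longrightarrow> i < k \<Longrightarrow> k < j \<Longrightarrow> False"
  unfolding simple_roots_def
  by (metis (mono_tags, lifting) mem_Collect_eq root_vec_add root_vec_in_pos_roots_iff)

lemma ht_simple_root: "v \<in> simple_roots \<Longrightarrow> ht (aff v 0) = 1"
proof -
  assume v: "v \<in> simple_roots"
  then obtain i j where ij: "v = root_vec i j" "i < j"
    using simple_roots_subset_pos_roots by (auto simp: pos_roots_def)
  have "{..<j} = insert i {..<i}"
    using ij v simple_roots_not_between[of i j] by (auto) (meson linorder_neqE)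
  then have "rk j = rk i + 1" by (simp add: rk_def)
  then show ?thesis by (simp add: ij ht_root_vec)
qed

lemma highest_root_in_pos_roots:
  assumes "CARD('n) \<ge> 2" shows "(highest_root :: 'n::{finite,linorder} rvec) \<in> pos_roots"
proof -
  have "Min UNIV \<noteq> (Max UNIV :: 'n)"
  proof
    assume "Min UNIV = (Max UNIV :: 'n)"
    then have "x = y" for x y :: 'n
      by (metis Max_ge Min_le UNIV_I finite order_antisym)
    then have "card (UNIV :: 'n set) \<le> 1" by (auto simp: card_le_Suc0_iff_eq)
    with assms show False by simp
  qed
  then have "Min UNIV < (Max UNIV :: 'n)"
    by (simp add: order_less_le)
  then show ?thesis by (simp add: highest_root_def)
qed

lemma ht_affine_simple_root:
  assumes "x \<in> affine_simple_roots" shows "ht x = 1"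
proof -
  consider v where "v \<in> simple_roots" "x = aff v 0" | "x = aff (- highest_root) 1"
    using assms by (auto simp: affine_simple_roots_def)
  then show ?thesis
  proof cases
    case 1 then show ?thesis by (simp add: ht_simple_root)
  next
    case 2
    have "{..<Min UNIV :: 'a} = {}" "{..<Max UNIV :: 'a} = UNIV - {Max UNIV}"
      by (auto simp: not_less[symmetric]) (metis Max_ge UNIV_I finite order_less_le)
    then have "rk (Min UNIV :: 'a) = 0" "rk (Max UNIV :: 'a) = int CARD('a) - 1"
      by (simp_all add: rk_def card_Diff_singleton Suc_leI)
    then show ?thesis by (simp add: 2 highest_root_def uminus_root_vec ht_root_vec)
  qed
qed

text \<open>For n = 1 the vector \<open>highest_root\<close> is 0 and the additional simple root
  would be \<delta>, which is not real; hence the bound on n.\<close>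

lemma affine_simple_roots_subset:
  assumes "CARD('n) \<ge> 2"
  shows "(affine_simple_roots :: 'n::{finite,linorder} affine set) \<subseteq> affine_roots"
  using highest_root_in_pos_roots[OF assms] simple_roots_subset_pos_roots pos_roots_subset_roots uminus_roots
  by (fastforce simp: affine_simple_roots_def)

section \<open>Affine reflections and their effect on the signs of roots\<close>

section \<open>Affine reflections\<close>

lemma form_add_left: "form (x + y) z = form x z + form y z"
  and form_add_right: "form z (x + y) = form z x + form z y"
  and form_diff_left: "form (x - y) z = form x z - form y z"
  and form_diff_right: "form z (x - y) = form z x - form z y"
  and form_minus_left: "form (- x) z = - form x z"
  and form_minus_right: "form z (- x) = - form z x"
  and form_scale_left: "form (c *\<^sub>R x) z = c * form x z"
  and form_scale_right: "form z (c *\<^sub>R x) = c * form z x"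
  and form_commute: "form x z = form z x"
  by (cases x; cases y; cases z; simp add: algebra_simps inner_commute)+

lemmas form_simps = form_add_left form_add_right form_diff_left form_diff_right
  form_minus_left form_minus_right form_scale_left form_scale_right

lemma form_aff: "form (aff u k) (aff v l) = u \<bullet> v"
  by (simp add: aff_def)

lemma subspace_Vhat: "subspace Vhat"
  by (auto simp: subspace_def Vhat_def sum.distrib zero_prod_def simp flip: sum_distrib_left)

lemmas Vhat_intros = subspace_add[OF subspace_Vhat] subspace_diff[OF subspace_Vhat]
  subspace_scale[OF subspace_Vhat] subspace_neg[OF subspace_Vhat]

lemma affine_roots_subset_Vhat: "x \<in> affine_roots \<Longrightarrow> x \<in> Vhat"
  by (auto elim!: affine_rootsE simp: Vhat_def aff_def root_vec_sum_nth)

lemma form_affine_root: "x \<in> affine_roots \<Longrightarrow> form x x = 2"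
  by (auto simp: affine_roots_def form_aff root_norm)

lemma aff_refl_root:
  "a \<in> affine_roots \<Longrightarrow> x \<in> Vhat \<Longrightarrow> aff_refl a x = x - form a x *\<^sub>R a"
  by (simp add: aff_refl_def form_affine_root)

lemma aff_refl_in_Vhat: "a \<in> affine_roots \<Longrightarrow> x \<in> Vhat \<Longrightarrow> aff_refl a x \<in> Vhat"
  by (simp add: aff_refl_root Vhat_intros affine_roots_subset_Vhat)

lemma aff_refl_involution:
  assumes a: "a \<in> affine_roots" shows "aff_refl a (aff_refl a x) = x"
proof (cases "x \<in> Vhat")
  case True
  then have "aff_refl a x \<in> Vhat" using a by (rule aff_refl_in_Vhat[rotated])
  then show ?thesis
    using a True by (simp add: aff_refl_root form_simps form_affine_root algebra_simps)
qed (simp add: aff_refl_def)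

lemma aff_refl_comp_involution [simp]:
  assumes "a \<in> affine_roots"
  shows "aff_refl a \<circ> aff_refl a = id" "aff_refl a \<circ> (aff_refl a \<circ> w) = w"
  using assms by (auto simp: fun_eq_iff aff_refl_involution)

lemma aff_refl_self: "a \<in> affine_roots \<Longrightarrow> aff_refl a a = - a"
  by (simp add: aff_refl_root affine_roots_subset_Vhat form_affine_root scaleR_2)

lemma aff_refl_affine_root:
  assumes "a \<in> affine_roots" "x \<in> affine_roots" shows "aff_refl a x \<in> affine_roots"
proof -
  obtain u k where a: "a = aff u k" "u \<in> roots" using assms by (auto simp: affine_roots_def)
  obtain v l where x: "x = aff v l" "v \<in> roots" using assms by (auto simp: affine_roots_def)
  \<comment> \<open>The inner product must be an integer for the reflected root to have an integral
    coefficient at \<delta>.\<close>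
  obtain m :: int where m: "u \<bullet> v = of_int m"
  proof -
    have "\<exists>m::int. u \<bullet> v = of_int m"
      using root_inner_cases[OF a(2) x(2)]
      by (metis Ints_0 Ints_1 Ints_cases Ints_minus Ints_numeral empty_iff insertE)
    then show ?thesis using that by blast
  qed
  have "aff_refl a x = aff (v - (u \<bullet> v) *\<^sub>R u) (l - m * k)"
    using assms by (simp add: aff_refl_root affine_roots_subset_Vhat a x form_aff) (simp add: aff_def m)
  then show ?thesis using roots_reflect[OF a(2) x(2)] by simp
qed

text \<open>The usual conjugation formula for reflections, multiplied by \<open>aff_refl b\<close>
  so that a reflection can be moved past one letter of a word.\<close>

lemma aff_refl_conjugate:
  assumes a: "a \<in> affine_roots" and b: "b \<in> affine_roots"
  shows "aff_refl b \<circ> aff_refl (aff_refl b a) = aff_refl a \<circ> aff_refl b"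
proof
  fix x
  show "(aff_refl b \<circ> aff_refl (aff_refl b a)) x = (aff_refl a \<circ> aff_refl b) x"
  proof (cases "x \<in> Vhat")
    case True
    define c where "c = aff_refl b a"
    have c: "c = a - form b a *\<^sub>R b"
      using a b by (simp add: c_def aff_refl_root affine_roots_subset_Vhat)
    have cR: "c \<in> affine_roots" using a b by (simp add: c_def aff_refl_affine_root)
    have V: "x - form c x *\<^sub>R c \<in> Vhat" "x - form b x *\<^sub>R b \<in> Vhat"
      using a b cR True by (auto intro: Vhat_intros affine_roots_subset_Vhat)
    have "aff_refl b (aff_refl c x) = x - form c x *\<^sub>R c - form b (x - form c x *\<^sub>R c) *\<^sub>R b"
      by (simp only: aff_refl_root[OF cR True] aff_refl_root[OF b V(1)])
    also have "\<dots> = x - form b x *\<^sub>R b - form a (x - form b x *\<^sub>R b) *\<^sub>R a"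
      unfolding c
      by (simp add: form_simps form_affine_root[OF b] form_commute[of a b] algebra_simps)
    also have "\<dots> = aff_refl a (aff_refl b x)"
      by (simp only: aff_refl_root[OF b True] aff_refl_root[OF a V(2)])
    finally show ?thesis by (simp add: c_def)
  qed (simp add: aff_refl_def)
qed

text \<open>The height drops by \<open>form a x\<close>. A drop of at most 1 leaves it nonnegative,
  and it is never 0. A drop of 2 means that the finite parts agree, so \<open>x\<close> is
  \<open>a\<close> plus a positive multiple of \<delta> and has height at least 1 + n.\<close>

lemma aff_refl_simple_pos:
  fixes a x :: "'n::{finite,linorder} affine"
  assumes n: "CARD('n) \<ge> 2" and a: "a \<in> affine_simple_roots"
    and x: "x \<in> affine_roots" "ht x > 0" "x \<noteq> a"
  shows "ht (aff_refl a x) > 0"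
proof -
  have aR: "a \<in> affine_roots" using affine_simple_roots_subset[OF n] a by auto
  have ha: "ht a = 1" using a by (rule ht_affine_simple_root)
  have refl: "aff_refl a x = x - form a x *\<^sub>R a"
    using aR x(1) by (simp add: aff_refl_root affine_roots_subset_Vhat)
  have ht: "ht (aff_refl a x) = ht x - form a x"
    unfolding refl ht_diff ht_scale ha by simp
  have nz: "ht (aff_refl a x) \<noteq> 0"
    using aR x(1) by (intro affine_root_ht_nonzero aff_refl_affine_root)
  have x1: "ht x \<ge> 1" using affine_root_ht_pos x by blast
  obtain u k where au: "a = aff u k" "u \<in> roots" using aR by (auto simp: affine_roots_def)
  obtain v l where xv: "x = aff v l" "v \<in> roots" using x(1) by (auto simp: affine_roots_def)
  have f: "form a x = u \<bullet> v" by (simp add: au xv form_aff)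
  show ?thesis
  proof (cases "u \<bullet> v = 2")
    case True
    then have uv: "u = v" using au xv root_inner_eq_2 by blast
    have hx: "ht x = ht a + real CARD('n) * of_int (l - k)"
      unfolding au xv uv using ht_aff_shift[of v l] ht_aff_shift[of v k] by (simp add: algebra_simps)
    have "l \<noteq> k" using x(3) au xv uv by auto
    moreover have "\<not> l < k"
    proof
      assume "l < k"
      then have "real CARD('n) * of_int (l - k) \<le> real CARD('n) * (-1)"
        by (intro mult_left_mono) linarith+
      then show False using hx ha x(2) n by linarith
    qed
    ultimately have "real CARD('n) * of_int (l - k) \<ge> real CARD('n) * 1"
      by (intro mult_left_mono) linarith+
    then show ?thesis using hx ha ht f True nz n by linarith
  next
    case False
    then have "u \<bullet> v \<le> 1" using root_inner_cases[OF au(2) xv(2)] by auto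
    then show ?thesis using ht f nz x1 by linarith
  qed
qed

lemma aff_refl_simple_sign:
  fixes a x :: "'n::{finite,linorder} affine"
  assumes n: "CARD('n) \<ge> 2" and a: "a \<in> affine_simple_roots"
    and x: "x \<in> affine_roots" "x \<noteq> a" "x \<noteq> - a"
  shows "ht (aff_refl a x) > 0 \<longleftrightarrow> ht x > 0"
proof -
  have aR: "a \<in> affine_roots" using affine_simple_roots_subset[OF n] a by auto
  have m: "aff_refl a (- x) = - aff_refl a x"
    using aR x(1) by (simp add: aff_refl_root affine_roots_subset_Vhat Vhat_intros form_simps)
  have "- x \<noteq> a" using x(3) by auto
  then have "ht x < 0 \<Longrightarrow> ht (aff_refl a x) < 0"
    using aff_refl_simple_pos[OF n a, of "- x"] x(1)
    by (simp add: m ht_minus uminus_affine_roots)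
  then show ?thesis
    using aff_refl_simple_pos[OF n a x(1) _ x(2)] affine_root_ht_nonzero[OF x(1)] by fastforce
qed

section \<open>Isometries permuting the affine roots, and the exchange condition\<close>

section \<open>Elements of the affine Weyl group\<close>

text \<open>One simultaneous induction, since the formula for a reflection holds only on
  \<open>Vhat\<close> and linearity thus depends on invariance. The last claim supplies preimages of
  roots and replaces the use of an inverse element.\<close>

lemma What_properties:
  assumes "w \<in> What"
  shows "inj w" "\<And>x. x \<in> Vhat \<Longrightarrow> w x \<in> Vhat"
    and "\<And>x y. x \<in> Vhat \<Longrightarrow> y \<in> Vhat \<Longrightarrow> w (x + y) = w x + w y"
    and "\<And>c x. x \<in> Vhat \<Longrightarrow> w (c *\<^sub>R x) = c *\<^sub>R w x"
    and "\<And>x y. x \<in> Vhat \<Longrightarrow> y \<in> Vhat \<Longrightarrow> form (w x) (w y) = form x y"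
    and "\<And>x. x \<in> affine_roots \<Longrightarrow> w x \<in> affine_roots"
    and "\<And>x. x \<in> affine_roots \<Longrightarrow> \<exists>y\<in>affine_roots. w y = x"
proof -
  have "inj w \<and> (\<forall>x\<in>Vhat. w x \<in> Vhat)
    \<and> (\<forall>x\<in>Vhat. \<forall>y\<in>Vhat. w (x + y) = w x + w y \<and> form (w x) (w y) = form x y)
    \<and> (\<forall>c. \<forall>x\<in>Vhat. w (c *\<^sub>R x) = c *\<^sub>R w x)
    \<and> (\<forall>x\<in>affine_roots. w x \<in> affine_roots \<and> (\<exists>y\<in>affine_roots. w y = x))"
    (is "?P w") using assms
  proof induction
    case one show ?case by auto
  next
    case (mult a w)
    then have IH: "?P w" by simp
    have "inj (aff_refl a)" by (metis aff_refl_involution injI mult.hyps(1))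
    then have 1: "inj (aff_refl a \<circ> w)" using IH by (simp add: inj_compose)
    have 2: "(aff_refl a \<circ> w) x \<in> Vhat" if "x \<in> Vhat" for x
      using that IH mult.hyps(1) by (simp add: aff_refl_in_Vhat)
    have 3: "(aff_refl a \<circ> w) (x + y) = (aff_refl a \<circ> w) x + (aff_refl a \<circ> w) y
        \<and> form ((aff_refl a \<circ> w) x) ((aff_refl a \<circ> w) y) = form x y"
      if "x \<in> Vhat" "y \<in> Vhat" for x y
    proof -
      have "w x \<in> Vhat" "w y \<in> Vhat" "w x + w y \<in> Vhat" "w (x + y) = w x + w y"
        "form (w x) (w y) = form x y"
        using IH that by (auto intro: Vhat_intros)
      then show ?thesis using mult.hyps(1)
        by (simp add: aff_refl_root form_simps form_affine_root form_commute[of "w x" a] algebra_simps)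
    qed
    have 4: "(aff_refl a \<circ> w) (c *\<^sub>R x) = c *\<^sub>R (aff_refl a \<circ> w) x" if "x \<in> Vhat" for c x
    proof -
      have "w x \<in> Vhat" "c *\<^sub>R w x \<in> Vhat" "w (c *\<^sub>R x) = c *\<^sub>R w x"
        using IH that by (auto intro: Vhat_intros)
      then show ?thesis using mult.hyps(1)
        by (simp add: aff_refl_root form_simps algebra_simps)
    qed
    have 5: "(aff_refl a \<circ> w) x \<in> affine_roots" if "x \<in> affine_roots" for x
      using that IH mult.hyps(1) by (simp add: aff_refl_affine_root)
    have 6: "\<exists>y\<in>affine_roots. (aff_refl a \<circ> w) y = x" if xR: "x \<in> affine_roots" for x
    proof -
      obtain y where "y \<in> affine_roots" "w y = aff_refl a x"
        using IH aff_refl_affine_root[OF mult.hyps(1) xR] by blast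
      then show ?thesis using aff_refl_involution[OF mult.hyps(1), of x] by (intro bexI[of _ y]) auto
    qed
    show ?case using 1 2 3 4 5 6 by blast
  qed
  then show "inj w" "\<And>x. x \<in> Vhat \<Longrightarrow> w x \<in> Vhat"
    "\<And>x y. x \<in> Vhat \<Longrightarrow> y \<in> Vhat \<Longrightarrow> w (x + y) = w x + w y"
    "\<And>c x. x \<in> Vhat \<Longrightarrow> w (c *\<^sub>R x) = c *\<^sub>R w x"
    "\<And>x y. x \<in> Vhat \<Longrightarrow> y \<in> Vhat \<Longrightarrow> form (w x) (w y) = form x y"
    "\<And>x. x \<in> affine_roots \<Longrightarrow> w x \<in> affine_roots"
    "\<And>x. x \<in> affine_roots \<Longrightarrow> \<exists>y\<in>affine_roots. w y = x"
    by blast+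
qed

lemma What_minus:
  assumes "w \<in> What" "x \<in> affine_roots" shows "w (- x) = - w x"
  using What_properties(4)[OF assms(1) affine_roots_subset_Vhat[OF assms(2)], of "-1"] by simp

text \<open>\<delta> is orthogonal to every real root, so each reflection fixes it.\<close>

lemma What_delta: "w \<in> What \<Longrightarrow> w (0, 1, 0) = (0, 1, 0)"
proof (induction rule: What.induct)
  case (mult a w)
  have "((0, 1, 0) :: 'a affine) \<in> Vhat" by (simp add: Vhat_def)
  moreover have "form a (0, 1, 0) = 0" using mult.hyps(1) by (auto simp: affine_roots_def aff_def)
  ultimately show ?case using mult by (simp add: aff_refl_root)
qed simp

text \<open>Induction on the length of the word: peel off the first letter \<open>aff_refl b\<close>, which either
  keeps \<open>a\<close> positive, or satisfies \<open>b = a\<close> and is the letter to be deleted.\<close>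

lemma exchange:
  fixes a x :: "'n::{finite,linorder} affine"
  assumes n: "CARD('n) \<ge> 2"
    and "set ss \<subseteq> simple_refls" "a \<in> affine_roots" "ht a > 0" "ht x < 0"
    and "foldr (\<circ>) ss id x = a"
  shows "\<exists>ss'. set ss' \<subseteq> simple_refls \<and> length ss' < length ss
    \<and> aff_refl a \<circ> foldr (\<circ>) ss id = foldr (\<circ>) ss' id"
  using assms(2-)
proof (induction ss arbitrary: a)
  case Nil then show ?case by simp
next
  case (Cons s ss)
  then obtain b where b: "b \<in> affine_simple_roots" "s = aff_refl b" by (auto simp: simple_refls_def)
  have bR: "b \<in> affine_roots" using affine_simple_roots_subset[OF n] b by auto
  show ?case
  proof (cases "a = b")
    case True
    then have "aff_refl a \<circ> foldr (\<circ>) (s # ss) id = foldr (\<circ>) ss id"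
      using b bR by (simp only: foldr_Cons comp_apply aff_refl_comp_involution)
    moreover have "set ss \<subseteq> simple_refls" "length ss < length (s # ss)" using Cons.prems by auto
    ultimately show ?thesis by blast
  next
    case False
    let ?a = "aff_refl b a"
    have aR: "?a \<in> affine_roots" using bR Cons.prems by (simp add: aff_refl_affine_root)
    have "aff_refl b (foldr (\<circ>) ss id x) = a"
      using Cons.prems(5) b(2) by (metis comp_apply foldr.simps(2))
    then have "foldr (\<circ>) ss id x = ?a" using aff_refl_involution[OF bR] by metis
    moreover have "ht ?a > 0" using aff_refl_simple_pos[OF n b(1)] Cons.prems False by blast
    ultimately obtain ss' where ss': "set ss' \<subseteq> simple_refls" "length ss' < length ss"
      "aff_refl ?a \<circ> foldr (\<circ>) ss id = foldr (\<circ>) ss' id"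
      using Cons.IH[OF _ aR _ Cons.prems(4)] Cons.prems(1) by fastforce
    have "aff_refl a \<circ> foldr (\<circ>) (s # ss) id = (aff_refl a \<circ> aff_refl b) \<circ> foldr (\<circ>) ss id"
      by (simp add: b comp_assoc)
    also have "\<dots> = (aff_refl b \<circ> aff_refl ?a) \<circ> foldr (\<circ>) ss id"
      using aff_refl_conjugate[of a b] Cons.prems bR by simp
    also have "\<dots> = foldr (\<circ>) (s # ss') id"
      by (simp add: comp_assoc ss'(3) b)
    finally have "aff_refl a \<circ> foldr (\<circ>) (s # ss) id = foldr (\<circ>) (s # ss') id" .
    moreover have "set (s # ss') \<subseteq> simple_refls" "length (s # ss') < length (s # ss)"
      using ss' Cons.prems(1) by auto
    ultimately show ?thesis by blast
  qed
qed

section \<open>Left descents as signs of preimages, and pairs of simple reflections with product of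
  order 3\<close>

section \<open>Descents\<close>

definition generated :: "('n affine \<Rightarrow> 'n::{finite,linorder} affine) \<Rightarrow> bool" where
  "generated w \<longleftrightarrow> (\<exists>ss. set ss \<subseteq> simple_refls \<and> w = foldr (\<circ>) ss id)"

lemma generated_refl: "generated w \<Longrightarrow> s \<in> simple_refls \<Longrightarrow> generated (s \<circ> w)"
proof -
  assume "generated w" "s \<in> simple_refls"
  then obtain ss where "set ss \<subseteq> simple_refls" "w = foldr (\<circ>) ss id" by (auto simp: generated_def)
  then show ?thesis using \<open>s \<in> simple_refls\<close> unfolding generated_def
    by (intro exI[of _ "s # ss"]) simp
qed

lemma simple_reflE:
  fixes s :: "'n::{finite,linorder} affine \<Rightarrow> 'n affine"
  assumes "CARD('n) \<ge> 2" "s \<in> simple_refls"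
  obtains a where "a \<in> affine_simple_roots" "a \<in> affine_roots" "ht a = 1" "s = aff_refl a"
proof -
  obtain a where "a \<in> affine_simple_roots" "s = aff_refl a"
    using assms(2) unfolding simple_refls_def by blast
  then show ?thesis
    using that affine_simple_roots_subset[OF assms(1)] ht_affine_simple_root by blast
qed

text \<open>Deleting a letter, by \<open>exchange\<close>, from a shortest word for
  \<open>w\<close>.\<close>

lemma len_exchange:
  fixes a x :: "'n::{finite,linorder} affine"
  assumes n: "CARD('n) \<ge> 2" and "generated w" "a \<in> affine_roots" "ht a > 0" "ht x < 0" "w x = a"
  shows "len (aff_refl a \<circ> w) < len w"
proof -
  have "\<exists>k ss. length ss = k \<and> set ss \<subseteq> simple_refls \<and> w = foldr (\<circ>) ss id"
    using assms(2) by (auto simp: generated_def)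
  then have "\<exists>ss. length ss = len w \<and> set ss \<subseteq> simple_refls \<and> w = foldr (\<circ>) ss id"
    unfolding len_def by (rule LeastI_ex)
  then obtain ss where ss: "length ss = len w" "set ss \<subseteq> simple_refls" "w = foldr (\<circ>) ss id" by blast
  obtain ss' where "set ss' \<subseteq> simple_refls" "length ss' < length ss"
      "aff_refl a \<circ> w = foldr (\<circ>) ss' id"
    using exchange[OF n ss(2) assms(3-5)] ss assms by blast
  then have "len (aff_refl a \<circ> w) \<le> length ss'" unfolding len_def by (intro Least_le) blast
  then show ?thesis using \<open>length ss' < length ss\<close> ss by simp
qed

text \<open>A descent is used only through this drop in length; conversely, a drop in length under
  one reflection is already a Bruhat step.\<close>

lemma bruhat_less_len: "bruhat_less u w \<Longrightarrow> len u < len w"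
  unfolding bruhat_less_def by (induction rule: tranclp_induct) (auto simp: bruhat_step_def)

text \<open>If \<open>w\<close> is not a product of simple reflections, then \<open>len\<close> is the same junk value at \<open>w\<close> and
  at \<open>s \<circ> w\<close>. So no proof that the simple reflections generate \<open>What\<close> is required.\<close>

lemma left_descent_generated:
  fixes w :: "'n::{finite,linorder} affine \<Rightarrow> 'n affine"
  assumes n: "CARD('n) \<ge> 2" and s: "s \<in> left_descents w"
  shows "generated w"
proof (rule ccontr)
  assume ng: "\<not> generated w"
  have sr: "s \<in> simple_refls" and l: "len (s \<circ> w) < len w"
    using s by (auto simp: left_descents_def bruhat_less_len)
  obtain a where "a \<in> affine_roots" "s = aff_refl a" using simple_reflE[OF n sr] by metis
  \<comment> \<open>\<open>s\<close> is an involution, so a word for \<open>s \<circ> w\<close>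
    would give one for \<open>w\<close>.\<close>
  then have "\<not> generated (s \<circ> w)"
    using generated_refl[of "s \<circ> w" s] ng sr by auto
  then have "len (s \<circ> w) = len w"
    using ng unfolding len_def generated_def by (metis (no_types))
  with l show False by simp
qed

text \<open>Both directions are \<open>len_exchange\<close>: applied to \<open>w\<close> if
  \<open>x\<close> is negative, and otherwise to \<open>aff_refl a \<circ> w\<close>, which sends
  \<open>- x\<close> to \<open>a\<close> and is therefore longer than \<open>w\<close>.\<close>

lemma left_descent_iff:
  fixes w :: "'n::{finite,linorder} affine \<Rightarrow> 'n affine"
  assumes n: "CARD('n) \<ge> 2" and w: "w \<in> What" "generated w"
    and a: "a \<in> affine_simple_roots" and x: "x \<in> affine_roots" "w x = a"
  shows "aff_refl a \<in> left_descents w \<longleftrightarrow> ht x < 0"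
proof
  have aR: "a \<in> affine_roots" using affine_simple_roots_subset[OF n] a by auto
  have ha: "ht a > 0" using ht_affine_simple_root[OF a] by simp
  have sr: "aff_refl a \<in> simple_refls" using a by (simp add: simple_refls_def)
  show "ht x < 0" if d: "aff_refl a \<in> left_descents w"
  proof (rule ccontr)
    assume "\<not> ht x < 0"
    then have "ht (- x) < 0" using affine_root_ht_nonzero[OF x(1)] by (simp add: ht_minus)
    moreover have "(aff_refl a \<circ> w) (- x) = a"
      using x aR by (simp add: What_minus[OF w(1)] aff_refl_root affine_roots_subset_Vhat Vhat_intros
          form_simps form_affine_root scaleR_2)
    ultimately have "len (aff_refl a \<circ> (aff_refl a \<circ> w)) < len (aff_refl a \<circ> w)"
      using len_exchange[OF n generated_refl[OF w(2) sr] aR ha] by blast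
    then show False using aR d by (auto simp: left_descents_def dest!: bruhat_less_len)
  qed
  show "aff_refl a \<in> left_descents w" if "ht x < 0"
  proof -
    have "len (aff_refl a \<circ> w) < len w" using len_exchange[OF n w(2) aR ha that x(2)] .
    then have "bruhat_step (aff_refl a \<circ> w) w"
      unfolding bruhat_step_def using aR w(1) by (auto intro: What.mult intro!: bexI[of _ a])
    then show ?thesis using sr by (auto simp: left_descents_def bruhat_less_def)
  qed
qed

text \<open>The other possible values are excluded one by one: 2 forces \<open>a = b\<close>, 1
  makes \<open>b - a\<close> a root of height 0, 0 makes the reflections commute, and -2 makes their
  product of infinite order.\<close>

lemma order_three_form:
  fixes a b :: "'n::{finite,linorder} affine"
  assumes n: "CARD('n) \<ge> 2" and a: "a \<in> affine_simple_roots" and b: "b \<in> affine_simple_roots"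
    and o3: "order_three (aff_refl a \<circ> aff_refl b)"
  shows "form a b = -1"
proof -
  have aR: "a \<in> affine_roots" and bR: "b \<in> affine_roots"
    using affine_simple_roots_subset[OF n] a b by auto
  have V: "a \<in> Vhat" "b \<in> Vhat" using aR bR by (auto intro: affine_roots_subset_Vhat)
  have h: "ht a = 1" "ht b = 1" using a b by (auto simp: ht_affine_simple_root)
  let ?f = "aff_refl a \<circ> aff_refl b"
  have f3: "?f (?f (?f x)) = x" for x
    using o3 by (auto simp: order_three_def numeral_3_eq_3 dest: fun_cong)
  have f1: "?f \<noteq> id" and f2: "?f \<circ> ?f \<noteq> id"
  proof -
    have "?f ^^ 1 \<noteq> id" "?f ^^ 2 \<noteq> id" using o3 unfolding order_three_def by auto
    then show "?f \<noteq> id" "?f \<circ> ?f \<noteq> id" by (simp_all add: numeral_2_eq_2)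
  qed
  obtain u k where au: "a = aff u k" "u \<in> roots" using aR by (auto simp: affine_roots_def)
  obtain v l where bv: "b = aff v l" "v \<in> roots" using bR by (auto simp: affine_roots_def)
  have f: "form a b = u \<bullet> v" by (simp add: au bv form_aff)
  have "form a b \<in> {-2, -1, 0, 1, 2}" unfolding f using au(2) bv(2) by (rule root_inner_cases)
  moreover have "form a b \<noteq> 2"
  proof
    assume "form a b = 2"
    then have uv: "u = v" using f root_inner_eq_2 au bv by auto
    then have "ht (aff u k) = 1" "ht (aff u l) = 1" using h au bv by auto
    then have "real CARD('n) * of_int k = real CARD('n) * of_int l"
      using ht_aff_shift[of u k] ht_aff_shift[of u l] by linarith
    then have "k = l" by simp
    then have "a = b" using uv au bv by simp
    then show False using f1 aR by simp
  qed
  moreover have "form a b \<noteq> 1"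
  proof
    assume "form a b = 1"
    then have "aff_refl a b = b - a" using aR V by (simp add: aff_refl_root)
    then have "b - a \<in> affine_roots" using aff_refl_affine_root[OF aR bR] by simp
    then show False using affine_root_ht_nonzero[of "b - a"] h by (simp add: ht_diff)
  qed
  moreover have "form a b \<noteq> 0"
  proof
    assume 0: "form a b = 0"
    then have "aff_refl b a = a" using bR V by (simp add: aff_refl_root form_commute[of b a])
    then have "?f = aff_refl b \<circ> aff_refl a" using aff_refl_conjugate[OF aR bR] by simp
    then have "?f \<circ> ?f = aff_refl a \<circ> (aff_refl b \<circ> (aff_refl b \<circ> aff_refl a))"
      by (metis comp_assoc)
    then show False using f2 aR bR by simp
  qed
  moreover have "form a b \<noteq> -2"
  proof
    assume m: "form a b = -2"
    \<comment> \<open>For the value -2 the vector \<open>a + b\<close> is orthogonal to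
      \<open>a\<close> and \<open>b\<close>, so the product of reflections translates this line by
      2; three applications shift the height by 12.\<close>
    have e: "?f (a + c *\<^sub>R (a + b)) = a + (c + 2) *\<^sub>R (a + b)" for c
    proof -
      let ?x = "a + c *\<^sub>R (a + b)"
      have X: "?x \<in> Vhat" using V by (intro Vhat_intros)
      have ab: "form b ?x = -2" "form a (?x + 2 *\<^sub>R b) = -2"
        using m form_affine_root[OF aR] form_affine_root[OF bR] by (simp_all add: form_simps form_commute[of b a])
      have X': "?x + 2 *\<^sub>R b \<in> Vhat" using V by (intro Vhat_intros)
      have "aff_refl b ?x = ?x + 2 *\<^sub>R b"
        unfolding aff_refl_root[OF bR X] ab by simp
      moreover have "aff_refl a (?x + 2 *\<^sub>R b) = ?x + 2 *\<^sub>R b + 2 *\<^sub>R a"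
        unfolding aff_refl_root[OF aR X'] ab by simp
      ultimately show ?thesis by (simp add: algebra_simps)
    qed
    have "?f (?f (?f (a + 0 *\<^sub>R (a + b)))) = a + 6 *\<^sub>R (a + b)"
      unfolding e by simp
    then have "a + 6 *\<^sub>R (a + b) = a" using f3[of a] by simp
    then have "ht (a + 6 *\<^sub>R (a + b)) = ht a" by simp
    then show False by (simp add: ht_add ht_scale h)
  qed
  ultimately show ?thesis by auto
qed

section \<open>Effect of a star operation on dominance and on the combinatorial ideal\<close>

section \<open>Dominant elements\<close>

text \<open>A root that is not simple splits by definition into two positive roots; each has height
  at least 1, so both summands have smaller height.\<close>

lemma pos_root_induct [consumes 1, case_names simple add]:
  assumes "v \<in> pos_roots"
    and simple: "\<And>v. v \<in> simple_roots \<Longrightarrow> Q v"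
    and add: "\<And>u v. u \<in> pos_roots \<Longrightarrow> v \<in> pos_roots \<Longrightarrow> u + v \<in> pos_roots \<Longrightarrow> Q u \<Longrightarrow> Q v \<Longrightarrow> Q (u + v)"
  shows "Q (v :: 'n::{finite,linorder} rvec)"
proof -
  have "\<forall>v\<in>pos_roots. ht (aff v 0) < real m \<longrightarrow> Q v" for m :: nat
  proof (induction m)
    case 0
    then show ?case
      using ht_pos_root_iff pos_roots_subset_roots by (metis not_less_iff_gr_or_eq of_nat_0 subsetD)
  next
    case (Suc m)
    show ?case
    proof (intro ballI impI)
      fix v :: "'n rvec"
      assume v: "v \<in> pos_roots" "ht (aff v 0) < real (Suc m)"
      show "Q v"
      proof (cases "v \<in> simple_roots")
        case False
        then obtain u u' where u: "u \<in> pos_roots" "u' \<in> pos_roots" "v = u + u'"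
          using v by (auto simp: simple_roots_def)
        have p: "ht (aff u 0) \<ge> 1" "ht (aff u' 0) \<ge> 1"
          using u ht_pos_root_iff pos_roots_subset_roots affine_root_ht_pos aff_in_affine_roots
          by (meson subsetD)+
        moreover have "ht (aff v 0) = ht (aff u 0) + ht (aff u' 0)"
          using u aff_add[of u 0 u' 0] by (metis add_0 ht_add)
        ultimately have "ht (aff u 0) < real m" "ht (aff u' 0) < real m" using v by simp_all
        then show ?thesis using add u v Suc.IH by blast
      qed (rule simple)
    qed
  qed
  then show ?thesis using assms(1) reals_Archimedean2 by blast
qed

lemma What_aff_root: "w \<in> What \<Longrightarrow> v \<in> roots \<Longrightarrow> w (aff v k) \<in> affine_roots"
  by (rule What_properties(6)) simp_all

lemma What_aff_add:
  assumes "w \<in> What" "u \<in> roots" "v \<in> roots"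
  shows "w (aff (u + v) (k + l)) = w (aff u k) + w (aff v l)"
proof -
  have "aff u k \<in> Vhat" "aff v l \<in> Vhat" using assms by (auto intro!: affine_roots_subset_Vhat)
  then show ?thesis using What_properties(3)[OF assms(1)] by (metis aff_add)
qed

lemma dominant_ht_pos:
  assumes w: "w \<in> What" "dominant w" and v: "v \<in> pos_roots"
  shows "ht (w (aff v 0)) > 0"
  using v
proof (induction rule: pos_root_induct)
  case (simple v)
  then show ?case using w by (simp add: dominant_def aff_pos_iff)
next
  case (add u v)
  have "w (aff (u + v) 0) = w (aff u 0) + w (aff v 0)"
    using What_aff_add[OF w(1), of u v 0 0] add.hyps pos_roots_subset_roots by auto
  then show ?case using add.IH by (simp add: ht_add)
qed

lemma dominantI:
  assumes "w \<in> What" "\<And>v. v \<in> simple_roots \<Longrightarrow> ht (w (aff v 0)) > 0" shows "dominant w"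
proof -
  have "v \<in> roots" if "v \<in> simple_roots" for v
    using that simple_roots_subset_pos_roots pos_roots_subset_roots by blast
  then show ?thesis
    using assms What_aff_root[OF assms(1)] by (auto simp: dominant_def aff_pos_iff)
qed

lemma comb_ideal_iff:
  assumes "w \<in> What"
  shows "\<mu> \<in> comb_ideal w \<longleftrightarrow> \<mu> \<in> pos_roots \<and> ht (w (aff (- \<mu>) 1)) < 0"
proof -
  have "w (aff (- \<mu>) 1) \<in> affine_roots" if "\<mu> \<in> pos_roots"
    using that What_aff_root[OF assms uminus_roots] pos_roots_subset_roots by blast
  then show ?thesis by (auto simp: comb_ideal_def aff_neg_iff)
qed

lemma comb_ideal_subset: "comb_ideal w \<subseteq> pos_roots"
  by (auto simp: comb_ideal_def)

text \<open>\<open>w\<close> sends \<delta> - \<mu> - b to a negative root minus the positive root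
  \<open>w (aff b 0)\<close>.\<close>

lemma comb_ideal_add:
  assumes w: "w \<in> What" "dominant w" and \<mu>: "\<mu> \<in> comb_ideal w"
    and b: "b \<in> pos_roots" and s: "\<mu> + b \<in> roots"
  shows "\<mu> + b \<in> comb_ideal w"
proof -
  have R: "\<mu> \<in> roots" "b \<in> roots" "\<mu> \<in> pos_roots"
    using \<mu> b comb_ideal_subset pos_roots_subset_roots by blast+
  have "ht (aff (\<mu> + b) 0) = ht (aff \<mu> 0) + ht (aff b 0)"
    by (metis add_0 aff_add ht_add)
  then have "\<mu> + b \<in> pos_roots"
    using ht_pos_root_iff[OF s] ht_pos_root_iff R b by (metis add_pos_pos)
  moreover have "w (aff (- (\<mu> + b)) 1) = w (aff (- \<mu>) 1) - w (aff b 0)"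
    using What_aff_add[OF w(1), of "- \<mu>" "- b" 1 0] What_minus[OF w(1), of "aff b 0"] R
    by (simp add: uminus_roots uminus_aff)
  ultimately show ?thesis
    using dominant_ht_pos[OF w b] \<mu> by (simp add: comb_ideal_iff[OF w(1)] ht_diff)
qed

text \<open>\<open>elementary_step\<close> in terms of roots. The inner product -1 says that \<nu>
  reflects \<mu> to \<mu> + \<nu>. Levi stability becomes closure under subtracting \<nu> together
  with \<nu> \<notin> \<Phi>: the bracket of the root spaces of \<nu> and -\<nu> is a nonzero part
  of the Cartan subalgebra and would leave the ideal.\<close>

definition elementary_root_step ::
  "'n rvec set \<Rightarrow> 'n::{finite,linorder} rvec set \<Rightarrow> bool" where
  "elementary_root_step \<Phi> \<Psi> \<longleftrightarrow> (\<exists>\<mu>\<in>\<Phi>. \<exists>\<nu>\<in>simple_roots. \<Psi> = \<Phi> - {\<mu>} \<and> \<nu> \<bullet> \<mu> = -1 \<and> \<nu> \<notin> \<Phi>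
     \<and> (\<forall>\<eta>\<in>\<Phi>. \<eta> - \<nu> \<in> roots \<longrightarrow> \<eta> - \<nu> \<in> \<Phi>) \<and> (\<forall>b\<in>pos_roots. \<mu> - b \<notin> \<Phi>))"

text \<open>Among positive roots only \<open>a\<close> is made negative by
  \<open>aff_refl a\<close>, and no finite simple root is mapped to \<open>a\<close> by
  \<open>w\<close>.\<close>

lemma reflected_dominant:
  fixes a x :: "'n::{finite,linorder} affine"
  assumes n: "CARD('n) \<ge> 2" and w: "w \<in> What" "dominant w"
    and a: "a \<in> affine_simple_roots" and x: "w x = a"
    and not_simple: "\<And>v. v \<in> simple_roots \<Longrightarrow> x \<noteq> aff v 0"
  shows "dominant (aff_refl a \<circ> w)"
proof (rule dominantI)
  have aR: "a \<in> affine_roots" using affine_simple_roots_subset[OF n] a by auto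
  show "aff_refl a \<circ> w \<in> What" using aR w by (auto intro: What.mult)
  fix v :: "'n rvec" assume v: "v \<in> simple_roots"
  let ?y = "w (aff v 0)"
  have vp: "v \<in> pos_roots" using v simple_roots_subset_pos_roots by blast
  have y: "ht ?y > 0" using dominant_ht_pos[OF w vp] .
  have "?y \<in> affine_roots" using vp pos_roots_subset_roots What_aff_root[OF w(1)] by blast
  moreover have "?y \<noteq> a" using not_simple[OF v] x What_properties(1)[OF w(1)] by (auto dest: injD)
  ultimately show "ht ((aff_refl a \<circ> w) (aff v 0)) > 0"
    using aff_refl_simple_pos[OF n a] y by simp
qed

text \<open>The simple root of the elementary step is \<open>c\<close>: the inequalities force its \<open>\<delta>\<close>-coefficient to
  be 0 or 1, and the value 1 contradicts dominance.\<close>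

lemma star_comb_ideal:
  fixes a b x c :: "'n::{finite,linorder} affine"
  assumes n: "CARD('n) \<ge> 2" and w: "w \<in> What" "dominant w"
    and a: "a \<in> affine_simple_roots" and b: "b \<in> affine_simple_roots" and ab: "form a b = -1"
    and x: "x \<in> affine_roots" "w x = a" and c: "c \<in> affine_roots" "w c = b"
    and hx: "ht x < 0" and hc: "ht c > 0" and hxc: "ht (x + c) < 0"
  shows "comb_ideal (aff_refl a \<circ> w) = comb_ideal w
    \<or> elementary_root_step (comb_ideal w) (comb_ideal (aff_refl a \<circ> w))"
proof -
  have aR: "a \<in> affine_roots" and bR: "b \<in> affine_roots"
    using affine_simple_roots_subset[OF n] a b by auto
  have h: "ht a = 1" "ht b = 1" using a b by (auto simp: ht_affine_simple_root)
  have V: "x \<in> Vhat" "c \<in> Vhat" using x c by (auto intro: affine_roots_subset_Vhat)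
  have sw: "aff_refl a \<circ> w \<in> What" using aR w by (auto intro: What.mult)
  have inj: "inj w" by (rule What_properties(1)[OF w(1)])
  \<comment> \<open>A sign change needs the image to be \<open>a\<close> or \<open>- a\<close>, that
    is, \<delta> - \<kappa> to be \<open>x\<close> or \<open>- x\<close>; the first is impossible
    because \<delta> - \<kappa> is positive and \<open>x\<close> is negative.\<close>
  have sign: "ht (aff_refl a (w (aff (- \<kappa>) 1))) > 0 \<longleftrightarrow> ht (w (aff (- \<kappa>) 1)) > 0"
    if \<kappa>: "\<kappa> \<in> pos_roots" "aff (- \<kappa>) 1 \<noteq> - x" for \<kappa>
  proof (rule aff_refl_simple_sign[OF n a])
    have R: "aff (- \<kappa>) 1 \<in> affine_roots" using \<kappa> pos_roots_subset_roots uminus_roots by auto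
    show "w (aff (- \<kappa>) 1) \<in> affine_roots" using R by (rule What_properties(6)[OF w(1)])
    have "aff (- \<kappa>) 1 \<in> affine_pos_roots" using \<kappa> by (auto simp: affine_pos_roots_def)
    then have "aff (- \<kappa>) 1 \<noteq> x" using hx by (auto simp: affine_pos_roots_iff)
    then show "w (aff (- \<kappa>) 1) \<noteq> a" using inj x by (auto dest: injD)
    show "w (aff (- \<kappa>) 1) \<noteq> - a"
      using inj x(2) \<kappa>(2) What_minus[OF w(1) x(1)] by (metis injD)
  qed
  have memb: "\<kappa> \<in> comb_ideal (aff_refl a \<circ> w) \<longleftrightarrow> \<kappa> \<in> comb_ideal w"
    if "aff (- \<kappa>) 1 \<noteq> - x" for \<kappa>
  proof (cases "\<kappa> \<in> pos_roots")
    case True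
    then have "w (aff (- \<kappa>) 1) \<in> affine_roots" "aff_refl a (w (aff (- \<kappa>) 1)) \<in> affine_roots"
      using What_aff_root[OF w(1) uminus_roots] aff_refl_affine_root[OF aR] pos_roots_subset_roots
      by blast+
    then have "ht (w (aff (- \<kappa>) 1)) \<noteq> 0" "ht (aff_refl a (w (aff (- \<kappa>) 1))) \<noteq> 0"
      by (auto dest: affine_root_ht_nonzero)
    then show ?thesis
      using sign[OF True that] by (auto simp: comb_ideal_iff[OF w(1)] comb_ideal_iff[OF sw])
  qed (auto simp: comb_ideal_def)
  show ?thesis
  proof (cases "\<exists>\<mu>\<in>pos_roots. aff (- \<mu>) 1 = - x")
    case False
    then have "comb_ideal (aff_refl a \<circ> w) = comb_ideal w"
      using memb comb_ideal_subset by blast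
    then show ?thesis ..
  next
    case True
    then obtain \<mu> where \<mu>: "\<mu> \<in> pos_roots" "aff (- \<mu>) 1 = - x" by blast
    have \<mu>R: "\<mu> \<in> roots" using \<mu> pos_roots_subset_roots by blast
    have x_eq: "x = aff \<mu> (-1)" using \<mu>(2) by (metis minus_minus uminus_aff)
    have w\<mu>: "w (aff (- \<mu>) 1) = - a" using What_minus[OF w(1) x(1)] x \<mu>(2) by simp
    obtain \<nu> k where \<nu>: "c = aff \<nu> k" "\<nu> \<in> roots" using c by (auto simp: affine_roots_def)
    have fxc: "form x c = -1" using What_properties(5)[OF w(1) V] x c ab by simp
    have \<mu>\<nu>: "\<mu> \<bullet> \<nu> = -1" using fxc by (simp add: x_eq \<nu> form_aff)
    have xc: "x + c \<in> affine_roots"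
      using aff_refl_affine_root[OF x(1) c(1)] V x fxc by (simp add: aff_refl_root add.commute)
    have xc_eq: "x + c = aff (\<mu> + \<nu>) (k - 1)" by (simp add: x_eq \<nu> aff_add)
    have sumR: "\<mu> + \<nu> \<in> roots" using xc unfolding xc_eq by simp
    have k0: "k \<ge> 0"
    proof (rule ccontr)
      assume "\<not> k \<ge> 0"
      then have "real CARD('n) * of_int k \<le> real CARD('n) * (-1)" by (intro mult_left_mono) linarith+
      then show False using hc[unfolded \<nu>(1)] ht_aff_shift[of \<nu> k] ht_root_bound[OF \<nu>(2)] by linarith
    qed
    have k1: "k \<le> 1"
    proof (rule ccontr)
      assume "\<not> k \<le> 1"
      then have "real CARD('n) * 1 \<le> real CARD('n) * of_int (k - 1)" by (intro mult_left_mono) linarith+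
      then show False
        using hxc[unfolded xc_eq] ht_aff_shift[of "\<mu> + \<nu>" "k - 1"] ht_root_bound[OF sumR] by linarith
    qed
    have wxc: "w (x + c) = a + b" using What_properties(3)[OF w(1) V] x c by simp
    \<comment> \<open>For k = 1 the root \<open>x + c\<close> is finite and negative, so dominance
      would make its image negative; but that image is \<open>a + b\<close>, of height 2.\<close>
    have "k \<noteq> 1"
    proof
      assume "k = 1"
      then have e: "x + c = aff (\<mu> + \<nu>) 0" by (simp add: xc_eq)
      then have "\<mu> + \<nu> \<notin> pos_roots" using hxc ht_pos_root_iff[OF sumR] by simp
      then have "- (\<mu> + \<nu>) \<in> pos_roots" using pos_root_cases[OF sumR] by simp
      then have "ht (w (aff (- (\<mu> + \<nu>)) 0)) > 0" by (rule dominant_ht_pos[OF w])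
      moreover have "aff (- (\<mu> + \<nu>)) 0 = - (x + c)" unfolding e uminus_aff by simp
      ultimately show False
        using What_minus[OF w(1) xc] wxc h by (simp add: ht_minus ht_add ht_diff)
    qed
    then have k: "k = 0" using k0 k1 by simp
    then have \<nu>p: "\<nu> \<in> pos_roots" and w\<nu>: "w (aff \<nu> 0) = b"
      using hc c(2) ht_pos_root_iff[OF \<nu>(2)] \<nu> by auto
    \<comment> \<open>The image \<open>b\<close> has height 1, while a sum of two positive roots
      would have an image of height at least 2.\<close>
    have \<nu>s: "\<nu> \<in> simple_roots"
    proof (rule ccontr)
      assume "\<nu> \<notin> simple_roots"
      then obtain u v where uv: "u \<in> pos_roots" "v \<in> pos_roots" "\<nu> = u + v"
        using \<nu>p by (auto simp: simple_roots_def)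
      then have R: "u \<in> roots" "v \<in> roots" using pos_roots_subset_roots by blast+
      have "ht (w (aff u 0)) \<ge> 1" "ht (w (aff v 0)) \<ge> 1"
        using dominant_ht_pos[OF w] uv R What_aff_root[OF w(1)] affine_root_ht_pos by blast+
      moreover have "b = w (aff u 0) + w (aff v 0)"
        using What_aff_add[OF w(1) R, of 0 0] uv w\<nu> by simp
      ultimately show False using h by (simp add: ht_add)
    qed
    have ideal: "comb_ideal (aff_refl a \<circ> w) = comb_ideal w - {\<mu>}"
    proof -
      have "\<kappa> \<in> comb_ideal (aff_refl a \<circ> w) \<longleftrightarrow> \<kappa> \<in> comb_ideal w - {\<mu>}" for \<kappa>
      proof (cases "\<kappa> = \<mu>")
        case True
        have "aff_refl a (- a) = a" using aR aff_refl_self[OF aR] aff_refl_involution[OF aR, of a] by simp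
        then have "\<mu> \<notin> comb_ideal (aff_refl a \<circ> w)"
          using h by (simp add: comb_ideal_iff[OF sw] w\<mu>)
        then show ?thesis using True by simp
      next
        case False
        then have "aff (- \<kappa>) 1 \<noteq> - x" using \<mu>(2) by (metis aff_inject neg_equal_iff_equal)
        then show ?thesis using memb False by simp
      qed
      then show ?thesis by blast
    qed
    have \<mu>I: "\<mu> \<in> comb_ideal w"
      unfolding comb_ideal_iff[OF w(1)] w\<mu> ht_minus h using \<mu> by simp
    have w_shift: "w (aff (\<nu> - \<eta>) 1) = b + w (aff (- \<eta>) 1)" if "\<eta> \<in> roots" for \<eta>
      using What_aff_add[OF w(1) \<nu>(2) uminus_roots[OF that], of 0 1] w\<nu> by simp
    \<comment> \<open>\<open>w\<close> maps \<delta> - \<nu> to \<delta> - b, of height n -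
      1.\<close>
    have \<nu>I: "\<nu> \<notin> comb_ideal w"
    proof -
      have "w (aff 0 1) = b + w (aff (- \<nu>) 1)" using w_shift[OF \<nu>(2)] by simp
      moreover have "aff 0 1 = ((0, 1, 0) :: 'n affine)" by (simp add: aff_def)
      ultimately have "ht ((0, 1, 0) :: 'n affine) = 1 + ht (w (aff (- \<nu>) 1))"
        using What_delta[OF w(1)] h by (metis ht_add)
      moreover have "ht ((0, 1, 0) :: 'n affine) = real CARD('n)" by (simp add: ht_def)
      ultimately have "ht (w (aff (- \<nu>) 1)) > 0" using n by linarith
      then show ?thesis by (simp add: comb_ideal_iff[OF w(1)])
    qed
    \<comment> \<open>Positivity: \<eta> - \<nu> has height at least 0, and not 0. Membership: the
      height of \<open>w\<close> at \<delta> - \<eta> is at most -1, and adding \<open>b\<close>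
      raises it to at most 0, which a root cannot attain.\<close>
    have closed: "\<eta> - \<nu> \<in> comb_ideal w" if \<eta>: "\<eta> \<in> comb_ideal w" "\<eta> - \<nu> \<in> roots" for \<eta>
    proof -
      have \<eta>p: "\<eta> \<in> pos_roots" "\<eta> \<in> roots"
        using \<eta> comb_ideal_subset pos_roots_subset_roots by blast+
      have "aff (\<eta> - \<nu>) 0 = aff \<eta> 0 - aff \<nu> 0" by (simp add: aff_def zero_prod_def)
      then have "ht (aff (\<eta> - \<nu>) 0) = ht (aff \<eta> 0) - 1"
        by (simp add: ht_diff ht_simple_root[OF \<nu>s])
      moreover have "ht (aff \<eta> 0) \<ge> 1"
        using affine_root_ht_pos[of "aff \<eta> 0"] \<eta>p ht_pos_root_iff[OF \<eta>p(2)] by simp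
      moreover have "ht (aff (\<eta> - \<nu>) 0) \<noteq> 0" using \<eta>(2) by (intro affine_root_ht_nonzero) simp
      ultimately have p: "\<eta> - \<nu> \<in> pos_roots" using ht_pos_root_iff[OF \<eta>(2)] by linarith
      have "- (\<eta> - \<nu>) \<in> roots" using \<eta>(2) by (rule uminus_roots)
      then have R: "w (aff (\<nu> - \<eta>) 1) \<in> affine_roots" "w (aff (- \<eta>) 1) \<in> affine_roots"
        using What_aff_root[OF w(1)] uminus_roots[OF \<eta>p(2)] by auto
      have "- w (aff (- \<eta>) 1) \<in> affine_roots" "ht (- w (aff (- \<eta>) 1)) > 0"
        using \<eta>(1) R by (auto simp: comb_ideal_iff[OF w(1)] ht_minus intro: uminus_affine_roots)
      then have "ht (- w (aff (- \<eta>) 1)) \<ge> 1" by (rule affine_root_ht_pos)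
      then have "ht (w (aff (\<nu> - \<eta>) 1)) \<le> 0"
        by (simp add: w_shift[OF \<eta>p(2)] ht_add h ht_minus)
      then have "ht (w (aff (\<nu> - \<eta>) 1)) < 0" using affine_root_ht_nonzero[OF R(1)] by linarith
      then show ?thesis using p by (simp add: comb_ideal_iff[OF w(1)])
    qed
    \<comment> \<open>Here \<open>w\<close> takes the value - a + \<open>w (aff v 0)\<close>, whose
      height is at least -1 + 1.\<close>
    have gen: "\<mu> - v \<notin> comb_ideal w" if v: "v \<in> pos_roots" for v
    proof
      assume i: "\<mu> - v \<in> comb_ideal w"
      have vR: "v \<in> roots" using v pos_roots_subset_roots by blast
      have "w (aff (- (\<mu> - v)) 1) = - a + w (aff v 0)"
        using What_aff_add[OF w(1) uminus_roots[OF \<mu>R] vR, of 1 0] w\<mu> by simp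
      moreover have "ht (w (aff v 0)) \<ge> 1"
        using dominant_ht_pos[OF w v] What_aff_root[OF w(1)] vR affine_root_ht_pos by blast
      ultimately have "ht (w (aff (- (\<mu> - v)) 1)) \<ge> 0" by (simp add: ht_add ht_minus ht_diff h)
      then show False using i unfolding comb_ideal_iff[OF w(1)] by linarith
    qed
    have "elementary_root_step (comb_ideal w) (comb_ideal (aff_refl a \<circ> w))"
      unfolding elementary_root_step_def
      using ideal \<mu>\<nu> \<nu>I closed gen
      by (intro bexI[OF _ \<mu>I] bexI[OF _ \<nu>s]) (auto simp: inner_commute)
    then show ?thesis ..
  qed
qed

lemma card_insert_Int_eq_1:
  "s \<noteq> t \<Longrightarrow> card (A \<inter> {s, t}) = 1 \<longleftrightarrow> (s \<in> A) \<noteq> (t \<in> A)"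
  by (cases "s \<in> A"; cases "t \<in> A") auto

lemma DL_iff:
  fixes a b x c :: "'n::{finite,linorder} affine"
  assumes n: "CARD('n) \<ge> 2" and w: "w \<in> What" "generated w"
    and a: "a \<in> affine_simple_roots" and b: "b \<in> affine_simple_roots" and ab: "form a b = -1"
    and x: "x \<in> affine_roots" "w x = a" and c: "c \<in> affine_roots" "w c = b"
  shows "w \<in> DL (aff_refl a) (aff_refl b) \<longleftrightarrow> (ht x < 0) \<noteq> (ht c < 0)"
proof -
  have aR: "a \<in> affine_roots" and bR: "b \<in> affine_roots"
    using affine_simple_roots_subset[OF n] a b by auto
  \<comment> \<open>The set of two reflections must not collapse. Equality would give
    \<open>a + b\<close> = \<open>- a\<close>, with heights 2 and -1.\<close>
  have "aff_refl a \<noteq> aff_refl b"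
  proof
    assume "aff_refl a = aff_refl b"
    then have "a - form b a *\<^sub>R b = - a"
      using aff_refl_self[OF aR] aff_refl_root[OF bR affine_roots_subset_Vhat[OF aR]] by simp
    then have "ht (a - form b a *\<^sub>R b) = ht (- a)" by simp
    then show False using ab
      by (simp add: ht_add ht_diff ht_scale ht_minus ht_affine_simple_root[OF a] ht_affine_simple_root[OF b] form_commute[of b a])
  qed
  from card_insert_Int_eq_1[OF this, of "left_descents w"] show ?thesis
    using w left_descent_iff[OF n w a x] left_descent_iff[OF n w b c]
    unfolding DL_def mem_Collect_eq by blast
qed

text \<open>The second case of the sign analysis is the first one for \<open>aff_refl a \<circ> w\<close>, because the star
  operation is an involution.\<close>

lemma star_refl_step:
  fixes a b :: "'n::{finite,linorder} affine"
  assumes n: "CARD('n) \<ge> 2" and w: "w \<in> What" "dominant w"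
    and a: "a \<in> affine_simple_roots" and b: "b \<in> affine_simple_roots" and ab: "form a b = -1"
    and D: "w \<in> DL (aff_refl a) (aff_refl b)" "aff_refl a \<circ> w \<in> DL (aff_refl a) (aff_refl b)"
  defines "w' \<equiv> aff_refl a \<circ> w"
  shows "dominant w' \<and> (comb_ideal w' = comb_ideal w
    \<or> elementary_root_step (comb_ideal w) (comb_ideal w')
    \<or> elementary_root_step (comb_ideal w') (comb_ideal w))"
proof -
  have aR: "a \<in> affine_roots" and bR: "b \<in> affine_roots"
    using affine_simple_roots_subset[OF n] a b by auto
  have Va: "a \<in> Vhat" "b \<in> Vhat" using aR bR by (auto intro: affine_roots_subset_Vhat)
  have w': "w' \<in> What" using aR w by (auto simp: w'_def intro: What.mult)
  have "card (left_descents w \<inter> {aff_refl a, aff_refl b}) = 1" using D(1) unfolding DL_def by blast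
  then have "left_descents w \<inter> {aff_refl a, aff_refl b} \<noteq> {}" by (metis card.empty zero_neq_one)
  then have g: "generated w" using left_descent_generated[OF n] by blast
  then have g': "generated w'" using generated_refl a by (auto simp: w'_def simple_refls_def)
  obtain x where x: "x \<in> affine_roots" "w x = a" using What_properties(7)[OF w(1) aR] by blast
  obtain c where c: "c \<in> affine_roots" "w c = b" using What_properties(7)[OF w(1) bR] by blast
  have V: "x \<in> Vhat" "c \<in> Vhat" using x c by (auto intro: affine_roots_subset_Vhat)
  have fxc: "form x c = -1" using What_properties(5)[OF w(1) V] x c ab by simp
  have xc: "x + c \<in> affine_roots"
    using aff_refl_affine_root[OF x(1) c(1)] V x fxc by (simp add: aff_refl_root add.commute)
  \<comment> \<open>Preimages under the new element: \<open>aff_refl a\<close> sends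
    \<open>- a\<close> to \<open>a\<close> and \<open>a + b\<close> to \<open>b\<close>.\<close>
  have x': "- x \<in> affine_roots" "w' (- x) = a"
    using x aff_refl_self[OF aR] aff_refl_involution[OF aR, of a]
    by (simp_all add: w'_def uminus_affine_roots What_minus[OF w(1)])
  have "aff_refl a (a + b) = b"
    using aR Va ab by (simp add: aff_refl_root Vhat_intros form_simps form_affine_root)
  then have xc': "w' (x + c) = b"
    using What_properties(3)[OF w(1) V] x c by (simp add: w'_def)
  have nz: "ht x \<noteq> 0" "ht c \<noteq> 0" "ht (x + c) \<noteq> 0"
    using x c xc by (auto dest: affine_root_ht_nonzero)
  have d: "(ht x < 0) \<noteq> (ht c < 0)" using D(1) DL_iff[OF n w(1) g a b ab x c] by simp
  have d': "(ht (- x) < 0) \<noteq> (ht (x + c) < 0)"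
    using D(2) DL_iff[OF n w' g' a b ab x' xc xc'] unfolding w'_def by blast
  show ?thesis
  proof (cases "ht x < 0")
    case True
    then have s: "ht c > 0" "ht (x + c) < 0" using d d' nz by (auto simp: ht_minus)
    have "x \<noteq> aff v 0" if "v \<in> simple_roots" for v
      using True ht_simple_root[OF that] by auto
    then have "dominant w'" unfolding w'_def using reflected_dominant[OF n w a x(2)] by blast
    then show ?thesis
      using star_comb_ideal[OF n w a b ab x c True s] unfolding w'_def by blast
  next
    case False
    then have s: "ht (- x) < 0" "ht (x + c) > 0" "ht c < 0"
      using d d' nz by (auto simp: ht_minus)
    \<comment> \<open>Since \<open>x + c\<close> is positive although \<open>c\<close> is negative,
      \<open>x\<close> has height above 1 and cannot be a finite simple root.\<close>
    have "ht (- c) \<ge> 1"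
      using affine_root_ht_pos[OF uminus_affine_roots[OF c(1)]] s by (simp add: ht_minus)
    then have "ht x > 1" using s(2) by (simp add: ht_minus ht_add)
    then have "x \<noteq> aff v 0" if "v \<in> simple_roots" for v
      using ht_simple_root[OF that] by auto
    then have dom: "dominant w'" unfolding w'_def using reflected_dominant[OF n w a x(2)] by blast
    \<comment> \<open>This sum is \<open>c\<close>: the original sign of \<open>c\<close> is the
      third sign condition for the new element.\<close>
    have "ht (- x + (x + c)) < 0" using s by simp
    moreover have "aff_refl a \<circ> w' = w"
      unfolding w'_def by (rule aff_refl_comp_involution(2)[OF aR])
    ultimately show ?thesis
      using star_comb_ideal[OF n w' dom a b ab x' xc xc' s(1,2)] dom by metis
  qed
qed

text \<open>\<open>DL\<close> is symmetric in its two reflections, so it does not matter which of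
  them the star operation multiplies by.\<close>

lemma star_step_comb_ideal:
  fixes w w' :: "'n::{finite,linorder} affine \<Rightarrow> 'n affine"
  assumes n: "CARD('n) \<ge> 2" and w: "w \<in> What" "dominant w" and st: "star_step w w'"
  shows "w' \<in> What \<and> dominant w' \<and> (comb_ideal w' = comb_ideal w
    \<or> elementary_root_step (comb_ideal w) (comb_ideal w')
    \<or> elementary_root_step (comb_ideal w') (comb_ideal w))"
proof -
  obtain s t where s: "s \<in> simple_refls" and t: "t \<in> simple_refls" and o3: "order_three (s \<circ> t)"
    and D: "w \<in> DL s t" "{s \<circ> w, t \<circ> w} \<inter> DL s t = {w'}"
    using st by (auto simp: star_step_def)
  obtain a where a: "a \<in> affine_simple_roots" "a \<in> affine_roots" "s = aff_refl a"
    using simple_reflE[OF n s] by metis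
  obtain b where b: "b \<in> affine_simple_roots" "b \<in> affine_roots" "t = aff_refl b"
    using simple_reflE[OF n t] by metis
  have ab: "form a b = -1" using order_three_form[OF n a(1) b(1)] o3 a b by simp
  have D': "w' \<in> DL s t" "w' = s \<circ> w \<or> w' = t \<circ> w" using D(2) by auto
  have DLc: "DL s t = DL t s" by (simp add: DL_def insert_commute)
  have What: "w' \<in> What" using D'(1) by (simp add: DL_def)
  from D'(2) show ?thesis
  proof
    assume e: "w' = s \<circ> w"
    show ?thesis
      using star_refl_step[OF n w a(1) b(1) ab] D(1) D'(1) What unfolding e a b by blast
  next
    assume e: "w' = t \<circ> w"
    show ?thesis
      using star_refl_step[OF n w b(1) a(1)] ab D(1) D'(1) What form_commute[of a b]
      unfolding DLc unfolding e a b by metis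
  qed
qed

section \<open>From conjugates by P to supports of matrices in the standard basis\<close>

section \<open>Matrices supported on a set of roots\<close>

lemma matrix_inv_unique:
  assumes "A ** B = mat 1" "B ** A = mat 1" shows "matrix_inv A = B"
proof -
  have "\<exists>B. A ** B = mat 1 \<and> B ** A = mat 1" using assms by blast
  then have "A ** matrix_inv A = mat 1 \<and> matrix_inv A ** A = mat 1"
    unfolding matrix_inv_def by (rule someI_ex)
  then show ?thesis using assms by (metis matrix_mul_assoc matrix_mul_lid matrix_mul_rid)
qed

lemma matrix_inv_mult:
  assumes "invertible A"
  shows "A ** matrix_inv A = mat 1" "matrix_inv A ** A = mat 1"
    "A ** (matrix_inv A ** X) = X" "matrix_inv A ** (A ** X) = X"
proof -
  obtain B where "A ** B = mat 1" "B ** A = mat 1" using assms by (auto simp: invertible_def)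
  moreover from this have "matrix_inv A = B" by (rule matrix_inv_unique)
  ultimately show 1: "A ** matrix_inv A = mat 1" "matrix_inv A ** A = mat 1" by simp_all
  show "A ** (matrix_inv A ** X) = X" "matrix_inv A ** (A ** X) = X"
    by (simp_all add: matrix_mul_assoc 1)
qed

lemma conj_by_add: "conj_by P (X + Y) = conj_by P X + conj_by P Y"
proof -
  have "(A + B) ** C = A ** C + B ** C" for A B C :: "'a cmat"
    by (simp add: vec_eq_iff matrix_matrix_mult_def distrib_right sum.distrib)
  then show ?thesis by (simp add: conj_by_def matrix_add_ldistrib)
qed

lemma conj_by_diff: "conj_by P (X - Y) = conj_by P X - conj_by P Y"
  using conj_by_add[of P "X - Y" Y] by simp

lemma conj_by_0 [simp]: "conj_by P 0 = 0"
  using conj_by_diff[of P 0 0] by simp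

lemma conj_by_cscale: "conj_by P (cscale c X) = cscale c (conj_by P X)"
proof -
  have "A ** cscale c B = cscale c (A ** B)" for A B :: "'a cmat"
    by (simp add: cscale_def vec_eq_iff matrix_matrix_mult_def sum_distrib_left mult.left_commute)
  moreover have "cscale c A ** B = cscale c (A ** B)" for A B :: "'a cmat"
    by (simp add: cscale_def vec_eq_iff matrix_matrix_mult_def sum_distrib_left mult.assoc)
  ultimately show ?thesis by (simp add: conj_by_def)
qed

lemma conj_by_sum: "conj_by P (\<Sum>x\<in>A. f x) = (\<Sum>x\<in>A. conj_by P (f x))"
  by (induction A rule: infinite_finite_induct) (simp_all add: conj_by_add)

lemma conj_by_mult: "invertible P \<Longrightarrow> conj_by P X ** conj_by P Y = conj_by P (X ** Y)"
  by (simp add: conj_by_def matrix_mul_assoc[symmetric] matrix_inv_mult)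

lemma conj_by_bracket:
  "invertible P \<Longrightarrow> bracket (conj_by P X) (conj_by P Y) = conj_by P (bracket X Y)"
  by (simp add: bracket_def conj_by_mult conj_by_diff)

lemma conj_by_inverse: "invertible P \<Longrightarrow> matrix_inv P ** conj_by P X ** P = X"
  by (simp add: conj_by_def matrix_mul_assoc[symmetric] matrix_inv_mult)

lemma conj_by_inject: "invertible P \<Longrightarrow> conj_by P X = conj_by P Y \<longleftrightarrow> X = Y"
  by (metis conj_by_inverse)

lemma inj_conj_by: "invertible P \<Longrightarrow> inj (conj_by P)"
  by (rule injI) (simp add: conj_by_inject)

lemma conj_by_surj: "invertible P \<Longrightarrow> \<exists>Y. X = conj_by P Y"
  by (rule exI[of _ "matrix_inv P ** X ** P"])
    (simp add: conj_by_def matrix_mul_assoc[symmetric] matrix_inv_mult)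

lemma trace_conj_by: "invertible P \<Longrightarrow> trace (conj_by P X) = trace X"
  unfolding conj_by_def by (subst trace_mul_sym) (simp add: matrix_inv_mult)

text \<open>This reduces the action of the Borel subgroup for a general \<open>P\<close> to upper
  triangular matrices.\<close>

lemma conj_by_conj_by:
  assumes P: "invertible P" and T: "invertible T"
  shows "conj_by (conj_by P T) (conj_by P Y) = conj_by P (conj_by T Y)"
proof -
  have "matrix_inv (conj_by P T) = conj_by P (matrix_inv T)"
    using P T by (intro matrix_inv_unique)
      (simp_all add: conj_by_mult matrix_inv_mult, simp_all add: conj_by_def matrix_inv_mult)
  then show ?thesis
    unfolding conj_by_def[of "conj_by P T"] using P by (simp add: conj_by_mult) (simp add: conj_by_def)
qed

text \<open>For sets of roots this is the sum of the standard root spaces. As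
  \<open>root_vec i i\<close> is 0, membership of 0 in the set admits diagonal entries, so Cartan
  and Borel elements are covered too.\<close>

definition supported :: "'n rvec set \<Rightarrow> 'n::{finite,linorder} cmat set" where
  "supported \<Phi> = {Y. \<forall>i j. Y $ i $ j \<noteq> 0 \<longrightarrow> root_vec i j \<in> \<Phi>}"

lemma supported_mono: "\<Phi> \<subseteq> \<Psi> \<Longrightarrow> supported \<Phi> \<subseteq> supported \<Psi>"
  by (auto simp: supported_def)

lemma supported_add: "X \<in> supported \<Phi> \<Longrightarrow> Y \<in> supported \<Phi> \<Longrightarrow> X + Y \<in> supported \<Phi>"
  by (auto simp: supported_def) (metis add.right_neutral)

lemma supported_diff: "X \<in> supported \<Phi> \<Longrightarrow> Y \<in> supported \<Phi> \<Longrightarrow> X - Y \<in> supported \<Phi>"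
  by (auto simp: supported_def) (metis)

lemma supported_0 [simp]: "0 \<in> supported \<Phi>"
  by (simp add: supported_def)

lemma supported_cscale: "X \<in> supported \<Phi> \<Longrightarrow> cscale c X \<in> supported \<Phi>"
  by (auto simp: supported_def cscale_def)

lemma supported_sum: "(\<And>x. x \<in> A \<Longrightarrow> f x \<in> supported \<Phi>) \<Longrightarrow> (\<Sum>x\<in>A. f x) \<in> supported \<Phi>"
  by (induction A rule: infinite_finite_induct) (auto intro: supported_add)

text \<open>Matrix units multiply by adding weights: position (i, k) times (k, j) lands at (i, j).
  Only sums that are roots or 0 belong to a position, so closure is required for these
  alone.\<close>

lemma supported_mult:
  assumes A: "A \<in> supported \<Psi>" and B: "B \<in> supported \<Phi>"
    and sum: "\<And>a b. a \<in> \<Psi> \<Longrightarrow> b \<in> \<Phi> \<Longrightarrow> a + b \<in> insert 0 roots \<Longrightarrow> a + b \<in> \<Xi>"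
  shows "A ** B \<in> supported \<Xi>"
  unfolding supported_def
proof (intro CollectI allI impI)
  fix i j assume "(A ** B) $ i $ j \<noteq> 0"
  then obtain k where k: "A $ i $ k * B $ k $ j \<noteq> 0"
    unfolding matrix_matrix_mult_def by (metis (mono_tags, lifting) sum.neutral vec_lambda_beta)
  have "root_vec i k + root_vec k j = root_vec i j" by (rule root_vec_add)
  moreover have "root_vec i j \<in> insert 0 roots" by (cases "i = j") auto
  ultimately show "root_vec i j \<in> \<Xi>"
    using sum[of "root_vec i k" "root_vec k j"] A B k by (auto simp: supported_def)
qed

text \<open>Evaluating the weight equation at the coordinates of the difference of two weights shows that
  this difference has norm 0.\<close>

lemma root_space_eq:
  fixes P :: "'n::{finite,linorder} cmat"
  assumes P: "invertible P" and \<mu>: "\<mu> \<in> roots"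
  shows "root_space P \<mu> = conj_by P ` supported {\<mu>}"
proof -
  have tr: "(\<Sum>i\<in>UNIV. \<mu> $ i) = 0" using \<mu> by (auto simp: roots_def root_vec_sum_nth)
  have \<mu>0: "\<mu> \<noteq> 0" using root_norm[OF \<mu>] by auto
  define wt :: "(complex, 'n) vec \<Rightarrow> complex" where "wt d = (\<Sum>i\<in>UNIV. complex_of_real (\<mu> $ i) * d $ i)" for d
  have br: "bracket (diag d) Y $ k $ l = (d $ k - d $ l) * Y $ k $ l" for d and Y :: "'n cmat" and k l
  proof -
    have "(diag d ** Y) $ k $ l = d $ k * Y $ k $ l"
      by (simp add: matrix_matrix_mult_def diag_def if_distrib[of "\<lambda>x. x * _"] cong: if_cong)
    moreover have "(Y ** diag d) $ k $ l = Y $ k $ l * d $ l"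
      by (simp add: matrix_matrix_mult_def diag_def if_distrib[of "\<lambda>x. _ * x"] cong: if_cong)
    ultimately show ?thesis by (simp add: bracket_def algebra_simps)
  qed
  have "conj_by P Y \<in> root_space P \<mu> \<longleftrightarrow> Y \<in> supported {\<mu>}" for Y
  proof -
    have conj: "bracket (conj_by P (diag d)) (conj_by P Y) = cscale c (conj_by P Y)
        \<longleftrightarrow> bracket (diag d) Y = cscale c Y" for d c
      by (simp only: conj_by_bracket[OF P] conj_by_cscale[symmetric] conj_by_inject[OF P])
    have "conj_by P Y \<in> root_space P \<mu> \<longleftrightarrow> trace Y = 0 \<and>
       (\<forall>d. (\<Sum>i\<in>UNIV. d $ i) = 0 \<longrightarrow> bracket (diag d) Y = cscale (wt d) Y)"
      unfolding root_space_def sl_def mem_Collect_eq trace_conj_by[OF P] conj wt_def ..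
    also have "\<dots> \<longleftrightarrow> trace Y = 0 \<and>
       (\<forall>d. (\<Sum>i\<in>UNIV. d $ i) = 0 \<longrightarrow> (\<forall>k l. (d $ k - d $ l) * Y $ k $ l = wt d * Y $ k $ l))"
      by (simp add: vec_eq_iff br cscale_def)
    also have "\<dots> \<longleftrightarrow> Y \<in> supported {\<mu>}"
    proof (intro iffI conjI allI impI)
      assume H: "trace Y = 0 \<and>
       (\<forall>d. (\<Sum>i\<in>UNIV. d $ i) = 0 \<longrightarrow> (\<forall>k l. (d $ k - d $ l) * Y $ k $ l = wt d * Y $ k $ l))"
      show "Y \<in> supported {\<mu>}"
        unfolding supported_def
      proof (intro CollectI allI impI)
        fix k l assume Y: "Y $ k $ l \<noteq> 0"
        define v where "v = root_vec k l - \<mu>"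
        define d :: "(complex, 'n) vec" where "d = (\<chi> i. complex_of_real (v $ i))"
        have "(\<Sum>i\<in>UNIV. v $ i) = 0" by (simp add: v_def sum_subtractf tr root_vec_sum_nth)
        then have "(\<Sum>i\<in>UNIV. d $ i) = 0" by (simp add: d_def flip: of_real_sum)
        then have "(d $ k - d $ l) * Y $ k $ l = wt d * Y $ k $ l" using H by blast
        then have "d $ k - d $ l = wt d" using Y by simp
        moreover have "wt d = complex_of_real (\<mu> \<bullet> v)"
          by (simp add: wt_def d_def inner_vec_def)
        moreover have "d $ k - d $ l = complex_of_real (root_vec k l \<bullet> v)"
          by (simp add: d_def root_vec_inner)
        ultimately have "v \<bullet> v = 0" by (simp add: v_def inner_diff_left)
        then show "root_vec k l \<in> {\<mu>}" by (simp add: v_def)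
      qed
    next
      assume Y: "Y \<in> supported {\<mu>}"
      have "Y $ i $ i \<noteq> 0 \<longrightarrow> root_vec i i \<in> {\<mu>}" for i using Y unfolding supported_def by blast
      then have "Y $ i $ i = 0" for i using \<mu>0 by auto
      then show "trace Y = 0" by (simp add: trace_def)
      fix d :: "(complex, 'n) vec" and k l
      show "(d $ k - d $ l) * Y $ k $ l = wt d * Y $ k $ l"
      proof (cases "Y $ k $ l = 0")
        case False
        then have \<mu>': "\<mu> = root_vec k l" using Y by (auto simp: supported_def)
        have "complex_of_real (root_vec k l $ i) * d $ i = (if i = k then d $ i else 0) - (if i = l then d $ i else 0)"
          for i by (simp add: root_vec_nth)
        then have "wt d = d $ k - d $ l" by (simp add: wt_def \<mu>' sum_subtractf)
        then show ?thesis by simp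
      qed simp
    qed
    finally show ?thesis .
  qed
  note iff = this
  show ?thesis
  proof (intro equalityI subsetI)
    fix X assume X: "X \<in> root_space P \<mu>"
    obtain Y where "X = conj_by P Y" using conj_by_surj[OF P] by blast
    then show "X \<in> conj_by P ` supported {\<mu>}" using X iff by simp
  next
    fix X assume "X \<in> conj_by P ` supported {\<mu>}"
    then show "X \<in> root_space P \<mu>" using iff by auto
  qed
qed

lemma supported_decompose:
  assumes "\<Phi> \<subseteq> roots" "Y \<in> supported (\<Phi> :: 'n::{finite,linorder} rvec set)"
  defines "X \<equiv> \<lambda>\<mu>. \<chi> i j. if root_vec i j = \<mu> then Y $ i $ j else 0"
  shows "X \<mu> \<in> supported {\<mu>}" "(\<Sum>\<mu>\<in>\<Phi>. X \<mu>) = Y"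
proof -
  have f: "finite \<Phi>" using assms(1) finite_roots by (rule finite_subset)
  show "X \<mu> \<in> supported {\<mu>}" by (auto simp: X_def supported_def split: if_splits)
  have "(\<Sum>\<mu>\<in>\<Phi>. X \<mu>) $ i $ j = Y $ i $ j" for i j
    using assms(2) f by (auto simp: X_def supported_def)
  then show "(\<Sum>\<mu>\<in>\<Phi>. X \<mu>) = Y" by (simp add: vec_eq_iff)
qed

lemma ideal_of_eq:
  assumes P: "invertible P"
  shows "ideal_of P w = conj_by P ` supported (comb_ideal w)"
proof -
  let ?\<Phi> = "comb_ideal w"
  have R: "?\<Phi> \<subseteq> roots" using comb_ideal_subset pos_roots_subset_roots by blast
  show ?thesis
  proof (intro equalityI subsetI)
    fix Z assume "Z \<in> ideal_of P w"
    then obtain X where X: "Z = (\<Sum>\<mu>\<in>?\<Phi>. X \<mu>)" "\<forall>\<mu>\<in>?\<Phi>. X \<mu> \<in> root_space P \<mu>"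
      by (auto simp: ideal_of_def)
    then have "\<forall>\<mu>\<in>?\<Phi>. \<exists>Y\<in>supported {\<mu>}. X \<mu> = conj_by P Y"
      using root_space_eq[OF P] R by blast
    then obtain Y where Y: "\<forall>\<mu>\<in>?\<Phi>. Y \<mu> \<in> supported {\<mu>} \<and> X \<mu> = conj_by P (Y \<mu>)" by metis
    then have "(\<Sum>\<mu>\<in>?\<Phi>. Y \<mu>) \<in> supported ?\<Phi>"
      using supported_mono[of "{_}" ?\<Phi>] by (intro supported_sum) blast
    moreover have "Z = conj_by P (\<Sum>\<mu>\<in>?\<Phi>. Y \<mu>)" using X Y by (simp add: conj_by_sum)
    ultimately show "Z \<in> conj_by P ` supported ?\<Phi>" by blast
  next
    fix Z assume "Z \<in> conj_by P ` supported ?\<Phi>"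
    then obtain Y where Y: "Y \<in> supported ?\<Phi>" "Z = conj_by P Y" by blast
    define X where "X \<mu> = (\<chi> i j. if root_vec i j = \<mu> then Y $ i $ j else 0)" for \<mu>
    have "X \<mu> \<in> supported {\<mu>}" "(\<Sum>\<mu>\<in>?\<Phi>. X \<mu>) = Y" for \<mu>
      using supported_decompose[OF R Y(1)] by (simp_all add: X_def[abs_def])
    then have "Z = (\<Sum>\<mu>\<in>?\<Phi>. conj_by P (X \<mu>))" "\<forall>\<mu>\<in>?\<Phi>. conj_by P (X \<mu>) \<in> root_space P \<mu>"
      using Y R root_space_eq[OF P] by (auto simp flip: conj_by_sum)
    then show "Z \<in> ideal_of P w"
      unfolding ideal_of_def by (intro CollectI exI[of _ "\<lambda>\<mu>. conj_by P (X \<mu>)"]) auto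
  qed
qed

lemma supported_singleton_subset_iff:
  assumes "\<mu> \<in> roots" shows "supported {\<mu>} \<subseteq> supported \<Phi> \<longleftrightarrow> \<mu> \<in> \<Phi>"
proof
  obtain i j where \<mu>: "\<mu> = root_vec i j" "i \<noteq> j" using assms by (auto simp: roots_def)
  define E :: "'a cmat" where "E = (\<chi> k l. if k = i \<and> l = j then 1 else 0)"
  have "E \<in> supported {\<mu>}" by (auto simp: E_def supported_def \<mu> split: if_splits)
  moreover assume "supported {\<mu>} \<subseteq> supported \<Phi>"
  ultimately have "E \<in> supported \<Phi>" by blast
  then have "E $ i $ j \<noteq> 0 \<longrightarrow> root_vec i j \<in> \<Phi>" unfolding supported_def by blast
  then show "\<mu> \<in> \<Phi>" by (simp add: E_def \<mu>)
qed (auto intro: supported_mono[THEN subsetD])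

lemma ideal_roots_supported:
  assumes P: "invertible P" and \<Phi>: "\<Phi> \<subseteq> pos_roots"
  shows "ideal_roots P (conj_by P ` supported \<Phi>) = \<Phi>"
proof -
  have "root_space P \<mu> \<subseteq> conj_by P ` supported \<Phi> \<longleftrightarrow> \<mu> \<in> \<Phi>" if "\<mu> \<in> pos_roots" for \<mu>
  proof -
    have \<mu>: "\<mu> \<in> roots" using that pos_roots_subset_roots by blast
    have "conj_by P ` supported {\<mu>} \<subseteq> conj_by P ` supported \<Phi> \<longleftrightarrow> supported {\<mu>} \<subseteq> supported \<Phi>"
      by (rule inj_image_subset_iff[OF inj_conj_by[OF P]])
    then show ?thesis by (simp add: root_space_eq[OF P \<mu>] supported_singleton_subset_iff[OF \<mu>])
  qed
  then show ?thesis using \<Phi> by (auto simp: ideal_roots_def)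
qed

section \<open>Combinatorial ideals give subspaces stable under the Borel subgroup\<close>

section \<open>Stability under the Borel subgroup\<close>

text \<open>A permutation preserves the total of all positions, so no position can strictly
  increase.\<close>

lemma permutation_ge_imp_id:
  fixes p :: "'n::{finite,linorder} \<Rightarrow> 'n"
  assumes p: "p permutes UNIV" and ge: "\<And>i. i \<le> p i" shows "p = id"
proof
  fix i
  have le: "rk i \<le> rk (p i)" for i using ge[of i] rk_less_iff[of "p i" i] by (meson not_le)
  have "(\<Sum>i\<in>UNIV. rk (p i)) = (\<Sum>i\<in>UNIV. rk (i :: 'n))"
    using sum.permute[OF p, of rk] by (simp add: comp_def)
  then have "rk i = rk (p i)"
    using sum_mono_inv[of rk UNIV "\<lambda>i. rk (p i)" i] le by simp
  then show "p i = id i" using ge[of i] rk_less_iff[of i "p i"] by (simp add: order_less_le)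
qed

text \<open>A nonzero term of the Leibniz expansion uses only entries on or above the diagonal, so
  its permutation is the identity.\<close>

lemma upper_triangular_diag_nonzero:
  fixes T :: "'n::{finite,linorder} cmat"
  assumes "det T \<noteq> 0" and T: "\<And>i j. j < i \<Longrightarrow> T $ i $ j = 0"
  shows "T $ i $ i \<noteq> 0"
proof -
  obtain p where p: "p permutes (UNIV :: 'n set)" "of_int (sign p) * (\<Prod>i\<in>UNIV. T $ i $ p i) \<noteq> 0"
    using assms(1) unfolding det_def by (metis (mono_tags, lifting) mem_Collect_eq sum.neutral)
  then have nz: "T $ i $ p i \<noteq> 0" for i by simp
  then have "i \<le> p i" for i using T by (meson not_le)
  then have "p = id" using permutation_ge_imp_id p(1) by blast
  then show ?thesis using nz[of i] by simp
qed

lemma upper_triangular_inverse: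
  fixes T :: "'n::{finite,linorder} cmat"
  assumes "det T \<noteq> 0" and T: "\<And>i j. j < i \<Longrightarrow> T $ i $ j = 0" and S: "S ** T = mat 1"
  shows "j < i \<Longrightarrow> S $ i $ j = 0"
proof (induction j rule: measure_induct_rule[where f = "\<lambda>j. nat (rk j)"])
  case (less j)
  \<comment> \<open>Columns before j are covered by the induction hypothesis, rows of
    \<open>T\<close> after j by triangularity; only the diagonal term of the product
    remains.\<close>
  have z: "S $ i $ k * T $ k $ j = 0" if "k \<noteq> j" for k
  proof (cases "k < j")
    case True
    then have "nat (rk k) < nat (rk j)" using rk_less_iff[of k j] rk_bounds(1)[of k] by linarith
    then show ?thesis using less True by simp
  qed (use T that in simp)
  have "(S ** T) $ i $ j = (\<Sum>k\<in>UNIV. S $ i $ k * T $ k $ j)"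
    by (simp add: matrix_matrix_mult_def)
  also have "\<dots> = S $ i $ j * T $ j $ j"
  proof -
    have "(\<Sum>k\<in>UNIV - {j}. S $ i $ k * T $ k $ j) = 0" using z by (intro sum.neutral) blast
    then show ?thesis by (subst sum.remove[of _ j]) auto
  qed
  finally have "S $ i $ j * T $ j $ j = (S ** T) $ i $ j" ..
  also have "\<dots> = 0" unfolding S using less.prems by (simp add: mat_def)
  finally have "S $ i $ j * T $ j $ j = 0" .
  then show ?case using upper_triangular_diag_nonzero[OF assms(1) T] by simp
qed

definition root_ideal :: "'n::{finite,linorder} rvec set \<Rightarrow> bool" where
  "root_ideal \<Phi> \<longleftrightarrow> \<Phi> \<subseteq> pos_roots \<and>
     (\<forall>\<mu>\<in>\<Phi>. \<forall>b\<in>pos_roots. \<mu> + b \<in> roots \<longrightarrow> \<mu> + b \<in> \<Phi>)"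

lemma root_ideal_comb_ideal: "w \<in> What \<Longrightarrow> dominant w \<Longrightarrow> root_ideal (comb_ideal w)"
  by (simp add: root_ideal_def comb_ideal_subset comb_ideal_add)

lemma pos_roots_add_nonzero: "u \<in> pos_roots \<Longrightarrow> v \<in> pos_roots \<Longrightarrow> u + v \<noteq> 0"
proof
  assume uv: "u \<in> pos_roots" "v \<in> pos_roots" "u + v = 0"
  then have "ht (aff u 0) > 0" "ht (aff v 0) > 0"
    using ht_pos_root_iff pos_roots_subset_roots by blast+
  moreover have "ht (aff u 0) + ht (aff v 0) = ht (aff (u + v) 0)"
    by (metis add_0 aff_add ht_add)
  ultimately show False using uv(3) by (simp add: ht_def aff_def)
qed

text \<open>An upper triangular matrix and its inverse have weights 0 or positive, and adding such a
  weight to a root of \<Phi> stays in \<Phi>; so multiplication on either side preserves the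
  support.\<close>

lemma ad_nilpotent_ideal_supported:
  fixes P :: "'n::{finite,linorder} cmat"
  assumes P: "invertible P" and \<Phi>: "root_ideal \<Phi>"
  shows "ad_nilpotent_ideal P (conj_by P ` supported \<Phi>)"
  unfolding ad_nilpotent_ideal_def
proof (intro conjI ballI)
  have pos: "\<Phi> \<subseteq> pos_roots" using \<Phi> by (simp add: root_ideal_def)
  show "complex_subspace (conj_by P ` supported \<Phi>)"
    unfolding complex_subspace_def
  proof (intro conjI ballI allI)
    show "0 \<in> conj_by P ` supported \<Phi>" by (metis conj_by_0 image_eqI supported_0)
    fix X assume "X \<in> conj_by P ` supported \<Phi>"
    then obtain X' where X: "X = conj_by P X'" "X' \<in> supported \<Phi>" by blast
    show "cscale c X \<in> conj_by P ` supported \<Phi>" for c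
      unfolding X(1) conj_by_cscale[symmetric] by (intro imageI supported_cscale X(2))
    fix Y assume "Y \<in> conj_by P ` supported \<Phi>"
    then obtain Y' where Y: "Y = conj_by P Y'" "Y' \<in> supported \<Phi>" by blast
    show "X + Y \<in> conj_by P ` supported \<Phi>"
      unfolding X(1) Y(1) conj_by_add[symmetric] by (intro imageI supported_add X(2) Y(2))
  qed
  show "conj_by P ` supported \<Phi> \<subseteq> nilradical P"
  proof
    fix X assume "X \<in> conj_by P ` supported \<Phi>"
    then obtain Y where Y: "Y \<in> supported \<Phi>" "X = conj_by P Y" by blast
    have "Y $ i $ j = 0" if "j \<le> i" for i j
    proof (rule ccontr)
      assume "Y $ i $ j \<noteq> 0"
      then have "root_vec i j \<in> pos_roots" using Y(1) pos unfolding supported_def by blast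
      then show False using that by simp
    qed
    then show "X \<in> nilradical P" using Y by (auto simp: nilradical_def)
  qed
  fix g X assume "g \<in> borel_group P" "X \<in> conj_by P ` supported \<Phi>"
  then obtain T Y where T: "g = conj_by P T" "det T = 1" "\<And>i j. j < i \<Longrightarrow> T $ i $ j = 0"
    and Y: "Y \<in> supported \<Phi>" "X = conj_by P Y"
    by (auto simp: borel_group_def)
  have Ti: "invertible T" using T by (simp add: invertible_det_nz)
  have upper: "A \<in> supported (insert 0 pos_roots)" if A: "\<And>i j. j < i \<Longrightarrow> A $ i $ j = 0" for A :: "'n cmat"
    unfolding supported_def
  proof (intro CollectI allI impI)
    fix i j assume "A $ i $ j \<noteq> 0"
    then have "i \<le> j" using A by (meson not_le)
    then show "root_vec i j \<in> insert 0 pos_roots" by (cases "i = j") auto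
  qed
  have closed: "a + b \<in> \<Phi>" if "a \<in> insert 0 pos_roots" "b \<in> \<Phi>" "a + b \<in> insert 0 roots" for a b
  proof (cases "a = 0")
    case False
    then have a: "a \<in> pos_roots" using that by simp
    then have "a + b \<in> roots" using pos_roots_add_nonzero[of a b] that pos by auto
    then have "b + a \<in> roots" by (simp only: add.commute[of b a])
    then have "b + a \<in> \<Phi>" using \<Phi> a that(2) unfolding root_ideal_def by blast
    then show ?thesis by (simp only: add.commute[of a b])
  qed (use that in simp)
  have closed': "b + a \<in> \<Phi>" if "b \<in> \<Phi>" "a \<in> insert 0 pos_roots" "b + a \<in> insert 0 roots" for a b
    using closed[OF that(2,1)] that(3) by (simp only: add.commute[of a b])
  have "T ** Y \<in> supported \<Phi>"
    by (rule supported_mult[OF upper Y(1)]) (fact T(3), rule closed)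
  moreover have "matrix_inv T \<in> supported (insert 0 pos_roots)"
    by (rule upper, rule upper_triangular_inverse[of T])
      (use T matrix_inv_mult(2)[OF Ti] in simp_all)
  ultimately have "T ** Y ** matrix_inv T \<in> supported \<Phi>"
    by (rule supported_mult) (rule closed')
  then have "conj_by T Y \<in> supported \<Phi>" by (simp add: conj_by_def)
  then show "conj_by g X \<in> conj_by P ` supported \<Phi>"
    unfolding T(1) Y(2) conj_by_conj_by[OF P Ti] by (rule imageI)
qed

section \<open>From steps between sets of roots to elementary relations between ideals\<close>

section \<open>Elementary steps\<close>

text \<open>A Levi element has weights 0, \<nu> and -\<nu>. Both products in a bracket with an
  element of the ideal keep their support in \<Phi>, hence so does their difference.\<close>

lemma elementary_step_supported:
  fixes P :: "'n::{finite,linorder} cmat"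
  assumes P: "invertible P" and \<Phi>: "root_ideal \<Phi>" and st: "elementary_root_step \<Phi> \<Psi>"
  shows "elementary_step P (conj_by P ` supported \<Phi>) (conj_by P ` supported \<Psi>)"
proof -
  have pos: "\<Phi> \<subseteq> pos_roots" using \<Phi> by (simp add: root_ideal_def)
  obtain \<mu> \<nu> where \<mu>: "\<mu> \<in> \<Phi>" "\<Psi> = \<Phi> - {\<mu>}" "\<nu> \<bullet> \<mu> = -1" "\<forall>b\<in>pos_roots. \<mu> - b \<notin> \<Phi>"
    and \<nu>: "\<nu> \<in> simple_roots" "\<nu> \<notin> \<Phi>" "\<forall>\<eta>\<in>\<Phi>. \<eta> - \<nu> \<in> roots \<longrightarrow> \<eta> - \<nu> \<in> \<Phi>"
    using st by (auto simp: elementary_root_step_def)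
  have \<nu>p: "\<nu> \<in> pos_roots" and \<nu>R: "\<nu> \<in> roots" and \<mu>R: "\<mu> \<in> roots"
    using \<nu> \<mu> pos simple_roots_subset_pos_roots pos_roots_subset_roots by blast+
  have closed: "a + b \<in> \<Phi>" if ab: "a \<in> {0, \<nu>, - \<nu>}" "b \<in> \<Phi>" "a + b \<in> insert 0 roots" for a b
  proof -
    consider "a = 0" | "a = \<nu>" | "a = - \<nu>" using ab by blast
    then show ?thesis
    proof cases
      case 1 then show ?thesis using ab by simp
    next
      case 2
      then have "b + \<nu> \<in> roots" using ab pos pos_roots_add_nonzero[OF \<nu>p, of b] by (auto simp: add.commute)
      then have "b + \<nu> \<in> \<Phi>" using \<Phi> ab(2) \<nu>p unfolding root_ideal_def by blast
      then show ?thesis using 2 by (simp add: add.commute)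
    next
      case 3
      \<comment> \<open>Here \<nu> \<notin> \<Phi> is used: it keeps the product from acquiring
        diagonal entries.\<close>
      then have "b - \<nu> \<noteq> 0" using ab(2) \<nu>(2) by auto
      then show ?thesis using ab 3 \<nu>(3) by (simp add: add.commute)
    qed
  qed
  have closed': "b + a \<in> \<Phi>" if "b \<in> \<Phi>" "a \<in> {0, \<nu>, - \<nu>}" "b + a \<in> insert 0 roots" for a b
    using closed[OF that(2,1)] that(3) by (simp only: add.commute[of a b])
  have levi: "bracket X Y \<in> conj_by P ` supported \<Phi>"
    if X: "X \<in> levi P \<nu>" and Y: "Y \<in> conj_by P ` supported \<Phi>" for X Y
  proof -
    obtain d A B where X': "X = conj_by P (diag d) + conj_by P A + conj_by P B"
      and A: "A \<in> supported {\<nu>}" and B: "B \<in> supported {- \<nu>}"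
      using X root_space_eq[OF P \<nu>R] root_space_eq[OF P uminus_roots[OF \<nu>R]]
      by (auto simp: levi_def cartan_def)
    define Z where "Z = diag d + A + B"
    have "diag d \<in> supported {0}" by (auto simp: supported_def diag_def)
    moreover have "supported {0} \<subseteq> supported {0, \<nu>, - \<nu>}"
      "supported {\<nu>} \<subseteq> supported {0, \<nu>, - \<nu>}" "supported {- \<nu>} \<subseteq> supported {0, \<nu>, - \<nu>}"
      by (simp_all add: supported_mono)
    ultimately have Z: "Z \<in> supported {0, \<nu>, - \<nu>}"
      unfolding Z_def using A B by (meson subsetD supported_add)
    obtain Y' where Y': "Y' \<in> supported \<Phi>" "Y = conj_by P Y'" using Y by blast
    have "Z ** Y' \<in> supported \<Phi>" using Z Y'(1) by (rule supported_mult) (rule closed)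
    moreover have "Y' ** Z \<in> supported \<Phi>"
      using Y'(1) Z by (rule supported_mult) (rule closed')
    ultimately have "bracket Z Y' \<in> supported \<Phi>" by (simp add: bracket_def supported_diff)
    moreover have "X = conj_by P Z" by (simp only: X' Z_def conj_by_add)
    then have "bracket X Y = conj_by P (bracket Z Y')" by (simp only: Y'(2) conj_by_bracket[OF P])
    ultimately show ?thesis by blast
  qed
  have gen: "generator P (conj_by P ` supported \<Phi>) \<mu>"
    unfolding generator_def ideal_roots_supported[OF P pos] using \<mu> by blast
  have less: "root_less \<mu> (fin_refl \<nu> \<mu>)"
  proof -
    have e: "fin_refl \<nu> \<mu> - \<mu> = \<nu>" using \<mu>(3) root_norm[OF \<nu>R] by (simp add: fin_refl_def)
    have "\<nu> \<noteq> 0" using root_norm[OF \<nu>R] by auto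
    then have "\<mu> \<noteq> fin_refl \<nu> \<mu>" using e by auto
    moreover have "finite (simple_roots :: 'n rvec set)"
      using finite_roots simple_roots_subset_pos_roots pos_roots_subset_roots finite_subset by metis
    \<comment> \<open>The difference is \<nu> itself, so the coefficients are the indicator of
      \<nu>.\<close>
    then have "fin_refl \<nu> \<mu> - \<mu> = (\<Sum>\<alpha>\<in>simple_roots. real (if \<alpha> = \<nu> then 1 else 0) *\<^sub>R \<alpha>)"
      using \<nu>(1) by (simp add: e if_distrib[of real] if_distrib[of "\<lambda>c. c *\<^sub>R _"] cong: if_cong)
    ultimately show ?thesis unfolding root_less_def
      by (intro conjI exI[of _ "\<lambda>\<alpha>. if \<alpha> = \<nu> then 1 else 0"]) auto
  qed
  have sum: "direct_sum_of (conj_by P ` supported \<Phi>) (conj_by P ` supported \<Psi>) (root_space P \<mu>)"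
    unfolding direct_sum_of_def root_space_eq[OF P \<mu>R]
  proof
    show "conj_by P ` supported \<Phi> = {X + Y |X Y. X \<in> conj_by P ` supported \<Psi> \<and> Y \<in> conj_by P ` supported {\<mu>}}"
    proof (intro equalityI subsetI)
      fix X assume "X \<in> conj_by P ` supported \<Phi>"
      then obtain Y where Y: "Y \<in> supported \<Phi>" "X = conj_by P Y" by blast
      define A :: "'n cmat" where "A = (\<chi> i j. if root_vec i j = \<mu> then 0 else Y $ i $ j)"
      define B :: "'n cmat" where "B = (\<chi> i j. if root_vec i j = \<mu> then Y $ i $ j else 0)"
      have "Y = A + B" by (simp add: A_def B_def vec_eq_iff)
      then have "X = conj_by P A + conj_by P B" using Y by (simp add: conj_by_add)
      moreover have "A \<in> supported \<Psi>" "B \<in> supported {\<mu>}"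
        using Y(1) by (auto simp: A_def B_def supported_def \<mu>(2) split: if_splits)
      ultimately show "X \<in> {X + Y |X Y. X \<in> conj_by P ` supported \<Psi> \<and> Y \<in> conj_by P ` supported {\<mu>}}"
        by blast
    next
      fix X assume "X \<in> {X + Y |X Y. X \<in> conj_by P ` supported \<Psi> \<and> Y \<in> conj_by P ` supported {\<mu>}}"
      then obtain A B where AB: "X = conj_by P A + conj_by P B" "A \<in> supported \<Psi>" "B \<in> supported {\<mu>}"
        by blast
      have "supported \<Psi> \<subseteq> supported \<Phi>" "supported {\<mu>} \<subseteq> supported \<Phi>"
        using \<mu> by (auto intro!: supported_mono)
      then have "A + B \<in> supported \<Phi>" using AB by (intro supported_add) auto
      moreover have "X = conj_by P (A + B)" by (simp only: AB(1) conj_by_add)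
      ultimately show "X \<in> conj_by P ` supported \<Phi>" by blast
    qed
    have "A = 0" if "A \<in> supported \<Psi>" "A \<in> supported {\<mu>}" for A :: "'n cmat"
    proof -
      have "A $ i $ j = 0" for i j using that \<mu>(2) unfolding supported_def by blast
      then show ?thesis by (simp add: vec_eq_iff)
    qed
    then have "supported \<Psi> \<inter> supported {\<mu>} = {0 :: 'n cmat}" by auto
    then show "conj_by P ` supported \<Psi> \<inter> conj_by P ` supported {\<mu>} = {0}"
      by (simp flip: image_Int[OF inj_conj_by[OF P]])
  qed
  show ?thesis
    unfolding elementary_step_def
    by (intro bexI[OF _ \<nu>(1)] exI[of _ \<mu>] conjI ballI levi gen less sum)
qed

text \<open>The conclusion uses the reflexive closure because a star operation may leave the ideal
  unchanged.\<close>

lemma star_step_left_equivalent: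
  fixes P :: "'n::{finite,linorder} cmat" and w w' :: "'n affine \<Rightarrow> 'n affine"
  assumes n: "CARD('n) \<ge> 2" and P: "invertible P"
    and w: "w \<in> What" "dominant w" and st: "star_step w w'"
  shows "w' \<in> What" "dominant w'" "ad_nilpotent_ideal P (ideal_of P w')"
    "(elementarily_related P)\<^sup>*\<^sup>* (ideal_of P w) (ideal_of P w')"
proof -
  have s: "w' \<in> What" "dominant w'" "comb_ideal w' = comb_ideal w
    \<or> elementary_root_step (comb_ideal w) (comb_ideal w')
    \<or> elementary_root_step (comb_ideal w') (comb_ideal w)"
    using star_step_comb_ideal[OF n w st] by auto
  show "w' \<in> What" "dominant w'" using s by auto
  have R: "root_ideal (comb_ideal w)" "root_ideal (comb_ideal w')"
    using root_ideal_comb_ideal w s by auto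
  have I: "ad_nilpotent_ideal P (ideal_of P w)" "ad_nilpotent_ideal P (ideal_of P w')"
    using ad_nilpotent_ideal_supported[OF P] R by (auto simp: ideal_of_eq[OF P])
  show "ad_nilpotent_ideal P (ideal_of P w')" by (rule I)
  from s(3) show "(elementarily_related P)\<^sup>*\<^sup>* (ideal_of P w) (ideal_of P w')"
  proof (elim disjE)
    assume "comb_ideal w' = comb_ideal w"
    then show ?thesis by (simp add: ideal_of_eq[OF P])
  next
    assume "elementary_root_step (comb_ideal w) (comb_ideal w')"
    then have "elementarily_related P (ideal_of P w) (ideal_of P w')"
      using I elementary_step_supported[OF P R(1)] by (simp add: elementarily_related_def ideal_of_eq[OF P])
    then show ?thesis by blast
  next
    assume "elementary_root_step (comb_ideal w') (comb_ideal w)"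
    then have "elementarily_related P (ideal_of P w) (ideal_of P w')"
      using I elementary_step_supported[OF P R(2)] by (simp add: elementarily_related_def ideal_of_eq[OF P])
    then show ?thesis by blast
  qed
qed

theorem theorem5p6:
  fixes P :: "'n::{finite,linorder} cmat"
    and w\<^sub>1 w\<^sub>2 :: "'n affine \<Rightarrow> 'n affine"
  assumes "CARD('n) \<ge> 2"
    and "invertible P"
    and "w\<^sub>1 \<in> What" and "dominant w\<^sub>1"
    and "w\<^sub>2 \<in> What"
    and "PL_equivalent w\<^sub>1 w\<^sub>2"
  shows "dominant w\<^sub>2 \<and> left_equivalent P (ideal_of P w\<^sub>1) (ideal_of P w\<^sub>2)"
proof -
  have I: "ad_nilpotent_ideal P (ideal_of P w\<^sub>1)"
    unfolding ideal_of_eq[OF assms(2)]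
    by (intro ad_nilpotent_ideal_supported root_ideal_comb_ideal assms)
  have "star_step\<^sup>*\<^sup>* w\<^sub>1 w\<^sub>2" using assms(6) by (simp add: PL_equivalent_def)
  \<comment> \<open>Group membership and dominance of each intermediate element belong to the
    invariant, as the next star operation relies on them.\<close>
  then have "w\<^sub>2 \<in> What \<and> dominant w\<^sub>2 \<and> left_equivalent P (ideal_of P w\<^sub>1) (ideal_of P w\<^sub>2)"
  proof (induction rule: rtranclp_induct)
    case base
    then show ?case using assms I by (simp add: left_equivalent_def)
  next
    case (step v w)
    then show ?case
      using star_step_left_equivalent[OF assms(1,2), of v w] unfolding left_equivalent_def
      by (meson rtranclp_trans)
  qed
  then show ?thesis by blast
qed

end
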